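(* Let $m\ge2$ and $r=\frac{1}{4m}$. For each $k\in\{0,\dots,m-1\}$ there exist constants $a_k\in\mathbb R$ and $b_k\ne0$ such that, as $x\to r^-$, $$G_k(x)=a_k-b_k\sqrt{1-\frac xr}+O\!\left(1-\frac xr\right).$$ Consequently, as $n\to\infty$, $$[x^n]G_k(x)\sim\frac{b_k}{2\sqrt\pi}\,r^{-n}n^{-3/2}=\frac{b_k}{2\sqrt\pi}(4m)^n n^{-3/2}.$$ Moreover, for every ordered pair $(i,j)\in\{0,\dots,m-1\}^2$ there is a constant $A_{i,j}$ such that, as $x\to r^-$, $$N^{i,j}(x)=A_{i,j}-B_{i,j}\sqrt{1-\frac xr}+O\!\left(1-\frac xr\right),\qquad B_{i,j}=a_ib_j+a_jb_i,$$ and hence, as $n\to\infty$, $$N_n^{i,j}\sim\frac{B_{i,j}}{2\sqrt\pi}\,r^{-n}n^{-3/2}=\frac{B_{i,j}}{2\sqrt\pi}(4m)^n n^{-3/2}.$$ In particular all $m^2$ pair-sequences share the same dominant singularity $r$, the same exponential growth $(4m)^n$ and the same polynomial decay $n^{-3/2}$; only the constants depend on $(i,j)$.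
   Context: For an integer $m\ge2$ let $V_m=\{v_0<v_1<\cdots<v_{m-1}\}$ ($v_0=0$, $v_{m-1}=1$) be an $m$-element chain with Gödel implication $v_p\Rightarrow_G v_q=v_{m-1}$ if $p\le q$ and $v_p\Rightarrow_G v_q=v_q$ if $p>q$. For $n\ge1$, the $C_{n-1}$ full bracketings of $p_1\Rightarrow_G\cdots\Rightarrow_G p_n$ in $n$ distinct variables correspond to full binary trees with $n$ ordered leaves ($C_k$ are the Catalan numbers). Let $g_n^{(k)}$ be the number of pairs (bracketing, valuation $\{p_1,\dots,p_n\}\to V_m$) for which the formula evaluates to $v_k$; $\sum_k g_n^{(k)}=m^nC_{n-1}$. Put $G_k(x)=\sum_{n\ge1}g_n^{(k)}x^n$, which converges for $|x|<r=\frac1{4m}$. For $n\ge2$ let $N_n^{i,j}$ be the number of pairs (bracketing, valuation $\nu$) such that, writing the bracketing at its root as $\varphi\Rightarrow_G\psi$, $\nu(\varphi)=v_i$ and $\nu(\psi)=v_j$; set $N_1^{i,j}:=0$ and $N^{i,j}(x)=\sum_{n\ge1}N_n^{i,j}x^n$. $[x^n]$ denotes coefficient extraction. *)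

theory Defs
  imports
    "HOL-Analysis.Analysis"
    "HOL-Library.FuncSet"
    "HOL-Library.Landau_Symbols"
begin

text \<open>The \<open>m\<close>-element chain \<open>v\<^sub>0 < \<dots> < v\<^sub>m\<^sub>-\<^sub>1\<close> is represented by the indices
  \<open>{..<m}\<close> with their usual order; the index \<open>m - 1\<close> is the truth value 1.\<close>

definition godel_imp :: "nat \<Rightarrow> nat \<Rightarrow> nat \<Rightarrow> nat" where
  "godel_imp m p q = (if p \<le> q then m - 1 else q)"

datatype fm = Var nat | Imp fm fm

fun vars :: "fm \<Rightarrow> nat list" where
  "vars (Var i) = [i]"
| "vars (Imp \<phi> \<psi>) = vars \<phi> @ vars \<psi>"

fun truth_value :: "nat \<Rightarrow> (nat \<Rightarrow> nat) \<Rightarrow> fm \<Rightarrow> nat" where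
  "truth_value m \<nu> (Var i) = \<nu> i"
| "truth_value m \<nu> (Imp \<phi> \<psi>) = godel_imp m (truth_value m \<nu> \<phi>) (truth_value m \<nu> \<psi>)"

text \<open>The full bracketings of \<open>p\<^sub>1 \<Rightarrow> \<dots> \<Rightarrow> p\<^sub>n\<close> are the formulas whose variables, read
  from left to right, are \<open>p\<^sub>1, \<dots>, p\<^sub>n\<close>.\<close>

definition bracketings :: "nat \<Rightarrow> fm set" where
  "bracketings n = {\<phi>. vars \<phi> = [1..<Suc n]}"

text \<open>The extensional function space makes distinct elements differ on \<open>{1..n}\<close>,
  so that valuations of \<open>p\<^sub>1, \<dots>, p\<^sub>n\<close> are counted once.\<close>

definition valuations :: "nat \<Rightarrow> nat \<Rightarrow> (nat \<Rightarrow> nat) set" where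
  "valuations m n = {1..n} \<rightarrow>\<^sub>E {..<m}"

definition g_count :: "nat \<Rightarrow> nat \<Rightarrow> nat \<Rightarrow> nat" where
  "g_count m k n =
     card {(\<phi>, \<nu>). \<phi> \<in> bracketings n \<and> \<nu> \<in> valuations m n \<and> truth_value m \<nu> \<phi> = k}"

text \<open>For \<open>n = 1\<close> the only bracketing is a variable, so the set below is empty and the
  convention \<open>N\<^sub>1 = 0\<close> holds automatically. For \<open>n = 0\<close> there are no bracketings, so both
  generating functions below have constant coefficient 0.\<close>

definition N_count :: "nat \<Rightarrow> nat \<Rightarrow> nat \<Rightarrow> nat \<Rightarrow> nat" where
  "N_count m i j n =
     card {(\<theta>, \<nu>). \<theta> \<in> bracketings n \<and> \<nu> \<in> valuations m n \<and>
       (\<exists>\<phi> \<psi>. \<theta> = Imp \<phi> \<psi> \<and> truth_value m \<nu> \<phi> = i \<and> truth_value m \<nu> \<psi> = j)}"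

definition G_gf :: "nat \<Rightarrow> nat \<Rightarrow> 'a :: semiring_1 fps" where
  "G_gf m k = Abs_fps (\<lambda>n. of_nat (g_count m k n))"

definition N_gf :: "nat \<Rightarrow> nat \<Rightarrow> nat \<Rightarrow> 'a :: semiring_1 fps" where
  "N_gf m i j = Abs_fps (\<lambda>n. of_nat (N_count m i j n))"

text \<open>The dominant singularities of a power series: the points of its circle of convergence
  near which its sum has no holomorphic continuation.\<close>

definition dominant_singularities :: "complex fps \<Rightarrow> complex set" where
  "dominant_singularities f =
     {z. ereal (norm z) = fps_conv_radius f \<and>
       \<not> (\<exists>U h. open U \<and> z \<in> U \<and> h holomorphic_on U \<and>
            (\<forall>w \<in> U \<inter> ball 0 (norm z). h w = eval_fps f w))}"

lemma finite_fm_vars: "finite {\<phi>. vars \<phi> = xs}"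
proof (induction xs rule: length_induct)
  case (1 xs)
  have ne: "vars \<phi> \<noteq> []" for \<phi>
    by (induction \<phi>) auto
  let ?I = "{i. 0 < i \<and> i < length xs}"
  let ?S = "\<Union>i\<in>?I. (\<lambda>(a, b). Imp a b) `
              ({\<phi>. vars \<phi> = take i xs} \<times> {\<phi>. vars \<phi> = drop i xs})"
  have "{\<phi>. vars \<phi> = xs} \<subseteq> Var ` set xs \<union> ?S"
  proof
    fix \<phi> assume "\<phi> \<in> {\<phi>. vars \<phi> = xs}"
    then have v: "vars \<phi> = xs" by simp
    show "\<phi> \<in> Var ` set xs \<union> ?S"
    proof (cases \<phi>)
      case (Var x1)
      then show ?thesis using v by auto
    next
      case (Imp a b)
      have "length (vars a) \<in> ?I" "vars a = take (length (vars a)) xs"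
        "vars b = drop (length (vars a)) xs"
        using Imp v ne[of a] ne[of b] by auto
      then show ?thesis using Imp by blast
    qed
  qed
  moreover have "finite ?S"
  proof (rule finite_UN_I)
    show "finite ?I" by simp
    fix i assume "i \<in> ?I"
    then have "length (take i xs) < length xs" "length (drop i xs) < length xs" by auto
    with 1 have "finite {\<phi>. vars \<phi> = take i xs}" "finite {\<phi>. vars \<phi> = drop i xs}" by blast+
    then show "finite ((\<lambda>(a, b). Imp a b) `
              ({\<phi>. vars \<phi> = take i xs} \<times> {\<phi>. vars \<phi> = drop i xs}))"
      by blast
  qed
  ultimately show ?case
    using finite_subset by blast
qed

lemma finite_bracketings_valuations: "finite (bracketings n \<times> valuations m n)"
  unfolding bracketings_def valuations_def
  by (intro finite_cartesian_product finite_fm_vars finite_PiE) auto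

end

theory Submission
  imports Defs "HOL-Real_Asymp.Real_Asymp"
begin

text \<open>
  Write \<open>S\<^sub>k = G\<^sub>k + \<dots> + G\<^bsub>m-1\<^esub>\<close> and \<open>s = \<surd>(1 - x/r)\<close>. Then \<open>S\<^sub>0 = m x + S\<^sub>0\<^sup>2\<close>, i.e.
  \<open>S\<^sub>0 = (1 - s)/2\<close>, and for \<open>k < m - 1\<close> the series \<open>G\<^sub>k\<close> solves the quadratic equation
  \<open>G\<^sub>k = x + G\<^sub>k (S\<^sub>k - G\<^sub>k)\<close>, so everything follows by induction on \<open>k\<close>, together with
  \<open>G\<^bsub>m-1\<^esub> = S\<^bsub>m-1\<^esub>\<close> and \<open>N\<^bsup>i,j\<^esup> = G\<^sub>i G\<^sub>j\<close>. Expansions in \<open>s\<close> pass through the quadratic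
  equation by elementary estimates.

  The coefficient asymptotics need no transfer theorem. If \<open>u\<^sub>n\<close> and \<open>v\<^sub>n\<close> are
  \<open>O(n\<^bsup>-3/2\<^esup>)\<close>, then \<open>n\<^bsup>3/2\<^esup> (u * v)\<^sub>n\<close> is, up to \<open>o(1)\<close>, the sum of the convolutions
  of \<open>u\<close> with \<open>n\<^bsup>3/2\<^esup> v\<^sub>n\<close> and of \<open>v\<close> with \<open>n\<^bsup>3/2\<^esup> u\<^sub>n\<close>. Applied to the quadratic
  equation, this shows that \<open>y\<^sub>n = n\<^bsup>3/2\<^esup> r\<^sup>n [x\<^sup>n] G\<^sub>k\<close> satisfies
  \<open>y\<^sub>n = c + (w * y)\<^sub>n + o(1)\<close> with \<open>\<Sum>|w\<^sub>j| \<le> S\<^sub>k(r) \<le> 1/2\<close>, which forces convergence.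

  Away from \<open>r\<close>, \<open>G\<^sub>k\<close> continues across \<open>|z| = r\<close> because the discriminant
  \<open>(1 - S\<^sub>k)\<^sup>2 + 4z = (1 - S\<^bsub>k+1\<^esub> + G\<^sub>k)\<^sup>2\<close> is bounded away from 0 by
  \<open>|S\<^bsub>k+1\<^esub>| + |G\<^sub>k| \<le> S\<^sub>k(r) \<le> 1/2\<close>.
\<close>

section \<open>Counting bracketings with valuations\<close>

text \<open>Substituting truth values for variables merges a bracketing and a valuation into one
  tree, whose leaves carry values where \<open>Var\<close> carried variable indices.\<close>

fun relabel :: "(nat \<Rightarrow> nat) \<Rightarrow> fm \<Rightarrow> fm" where
  "relabel f (Var i) = Var (f i)"
| "relabel f (Imp \<phi> \<psi>) = Imp (relabel f \<phi>) (relabel f \<psi>)"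

lemma vars_nonempty [simp]: "vars \<phi> \<noteq> []"
  by (induction \<phi>) auto

lemma vars_relabel [simp]: "vars (relabel f \<phi>) = map f (vars \<phi>)"
  by (induction \<phi>) auto

lemma truth_value_relabel: "truth_value m id (relabel \<nu> \<phi>) = truth_value m \<nu> \<phi>"
  by (induction \<phi>) auto

text \<open>Relabelling keeps the shape, so the two left subformulas have equally many leaves. This
  cuts the common variable list at the same place, and the induction splits.\<close>

lemma relabel_inject:
  "vars \<phi> = vars \<phi>' \<Longrightarrow> relabel f \<phi> = relabel f' \<phi>' \<Longrightarrow> \<phi> = \<phi>'"
proof (induction \<phi> arbitrary: \<phi>')
  case (Var i)
  then show ?case by (cases \<phi>') auto
next
  case (Imp a b)
  obtain a' b' where \<phi>': "\<phi>' = Imp a' b'"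
    using Imp.prems by (cases \<phi>') auto
  have eq: "relabel f a = relabel f' a'" "relabel f b = relabel f' b'"
    using Imp.prems \<phi>' by auto
  have "length (vars a) = length (vars a')"
    using arg_cong[OF eq(1), of "\<lambda>t. length (vars t)"] by simp
  then have "vars a = vars a'" "vars b = vars b'"
    using Imp.prems(1) \<phi>' by auto
  then show ?case using Imp.IH eq \<phi>' by auto
qed

text \<open>Writing \<open>xs\<close> on the leaves of \<open>t\<close> from left to right gives
  \<phi>. It depends only on \<open>xs\<close> and the shape of \<open>t\<close>, which is why it is
  chosen before \<nu>.\<close>

lemma relabel_surj:
  "length xs = length (vars t) \<Longrightarrow>
    \<exists>\<phi>. vars \<phi> = xs \<and> (\<forall>\<nu>. map \<nu> xs = vars t \<longrightarrow> relabel \<nu> \<phi> = t)"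
proof (induction t arbitrary: xs)
  case (Var i)
  then obtain x where "xs = [x]" by (auto simp: length_Suc_conv)
  then show ?case by (intro exI[of _ "Var x"]) auto
next
  case (Imp a b)
  define l where "l = length (vars a)"
  have "length (take l xs) = length (vars a)" "length (drop l xs) = length (vars b)"
    using Imp.prems by (auto simp: l_def)
  then obtain \<phi> \<psi> where 
    \<phi>: "vars \<phi> = take l xs" "\<And>\<nu>. map \<nu> (take l xs) = vars a \<Longrightarrow> relabel \<nu> \<phi> = a" and
    \<psi>: "vars \<psi> = drop l xs" "\<And>\<nu>. map \<nu> (drop l xs) = vars b \<Longrightarrow> relabel \<nu> \<psi> = b"
    using Imp.IH(1)[of "take l xs"] Imp.IH(2)[of "drop l xs"] by blast
  show ?case
  proof (intro exI[of _ "Imp \<phi> \<psi>"] conjI allI impI)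
    show "vars (Imp \<phi> \<psi>) = xs" using \<phi> \<psi> by simp
    fix \<nu> assume *: "map \<nu> xs = vars (Imp a b)"
    have "map \<nu> (take l xs) = take l (map \<nu> xs)" "map \<nu> (drop l xs) = drop l (map \<nu> xs)"
      by (simp_all add: take_map drop_map)
    then show "relabel \<nu> (Imp \<phi> \<psi>) = Imp a b"
      using \<phi>(2) \<psi>(2) by (simp add: * l_def)
  qed
qed

text \<open>The index stored in \<open>Var\<close> is itself a truth value here, so these trees are
  evaluated under \<open>id\<close>. Unlike a bracketing, such a tree can be cut at its root without
  renumbering variables.\<close>

definition valued_trees :: "nat \<Rightarrow> nat \<Rightarrow> fm set" where
  "valued_trees m n = {t. length (vars t) = n \<and> set (vars t) \<subseteq> {..<m}}"

definition valued_trees_at :: "nat \<Rightarrow> nat \<Rightarrow> nat \<Rightarrow> fm set" where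
  "valued_trees_at m k n = {t \<in> valued_trees m n. truth_value m id t = k}"

lemma finite_valued_trees: "finite (valued_trees m n)"
proof -
  have "valued_trees m n \<subseteq> (\<Union>xs\<in>{xs. set xs \<subseteq> {..<m} \<and> length xs = n}. {\<phi>. vars \<phi> = xs})"
    unfolding valued_trees_def by auto
  moreover have "finite \<dots>"
    by (intro finite_UN_I finite_lists_length_eq finite_fm_vars) auto
  ultimately show ?thesis by (rule finite_subset)
qed

text \<open>The leaves of the image, read from left to right, list the values of \<nu> at 1, ..., n.
  So the image determines \<nu>, and its shape determines the bracketing.\<close>

lemma bij_betw_relabel:
  "bij_betw (\<lambda>(\<phi>, \<nu>). relabel \<nu> \<phi>) (bracketings n \<times> valuations m n) (valued_trees m n)"
proof (rule bij_betwI')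
  fix x y
  assume xy: "x \<in> bracketings n \<times> valuations m n" "y \<in> bracketings n \<times> valuations m n"
  obtain \<phi> \<nu> \<phi>' \<nu>' where [simp]: "x = (\<phi>, \<nu>)" "y = (\<phi>', \<nu>')" by fastforce
  have v: "vars \<phi> = [1..<Suc n]" "vars \<phi>' = [1..<Suc n]"
      and e: "\<nu> \<in> {1..n} \<rightarrow>\<^sub>E {..<m}" "\<nu>' \<in> {1..n} \<rightarrow>\<^sub>E {..<m}"
    using xy by (auto simp: bracketings_def valuations_def)
  show "((case x of (\<phi>, \<nu>) \<Rightarrow> relabel \<nu> \<phi>) = (case y of (\<phi>, \<nu>) \<Rightarrow> relabel \<nu> \<phi>)) = (x = y)"
  proof
    assume "(case x of (\<phi>, \<nu>) \<Rightarrow> relabel \<nu> \<phi>) = (case y of (\<phi>, \<nu>) \<Rightarrow> relabel \<nu> \<phi>)"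
    then have eq: "relabel \<nu> \<phi> = relabel \<nu>' \<phi>'" by simp
    then have "\<phi> = \<phi>'" using relabel_inject v by metis
    have "map \<nu> [1..<Suc n] = map \<nu>' [1..<Suc n]"
      using arg_cong[OF eq, of vars] v by (simp del: upt_Suc)
    then have "\<nu> i = \<nu>' i" if "i \<in> {1..n}" for i
      using that by (auto simp del: upt_Suc)
    then have "\<nu> = \<nu>'" using e by (intro PiE_ext) auto
    with \<open>\<phi> = \<phi>'\<close> show "x = y" by simp
  qed auto
next
  fix x assume "x \<in> bracketings n \<times> valuations m n"
  then show "(case x of (\<phi>, \<nu>) \<Rightarrow> relabel \<nu> \<phi>) \<in> valued_trees m n"
    by (auto simp: bracketings_def valuations_def valued_trees_def PiE_def Pi_def simp del: upt_Suc)
next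
  fix t assume "t \<in> valued_trees m n"
  then have t: "length (vars t) = n" "set (vars t) \<subseteq> {..<m}"
    by (auto simp: valued_trees_def)
  obtain \<phi> where \<phi>: "vars \<phi> = [1..<Suc n]"
      "\<And>\<nu>. map \<nu> [1..<Suc n] = vars t \<Longrightarrow> relabel \<nu> \<phi> = t"
    using relabel_surj[of "[1..<Suc n]" t] t(1) by (auto simp del: upt_Suc)
  \<comment> \<open>List positions start at 0 and variables at 1; \<open>restrict\<close> makes
    \<nu> extensional, as \<open>valuations\<close> demands.\<close>
  define \<nu> where "\<nu> = restrict (\<lambda>i. vars t ! (i - 1)) {1..n}"
  have "map \<nu> [1..<Suc n] = vars t"
    using t by (intro nth_equalityI) (auto simp: \<nu>_def simp del: upt_Suc)
  then have "relabel \<nu> \<phi> = t" by (rule \<phi>(2))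
  moreover have "vars t ! (i - 1) < m" if "i \<in> {1..n}" for i
  proof -
    have "vars t ! (i - 1) \<in> set (vars t)" using that t(1) by (intro nth_mem) auto
    then show ?thesis using t(2) by blast
  qed
  then have "\<nu> \<in> valuations m n"
    by (auto simp: valuations_def \<nu>_def)
  ultimately show "\<exists>x\<in>bracketings n \<times> valuations m n. t = (case x of (\<phi>, \<nu>) \<Rightarrow> relabel \<nu> \<phi>)"
    using \<phi>(1) by (intro bexI[of _ "(\<phi>, \<nu>)"]) (auto simp: bracketings_def)
qed

lemma card_bracketings_valuations:
  assumes "\<And>\<phi> \<nu>. P \<phi> \<nu> \<longleftrightarrow> Q (relabel \<nu> \<phi>)"
  shows "card {(\<phi>, \<nu>). \<phi> \<in> bracketings n \<and> \<nu> \<in> valuations m n \<and> P \<phi> \<nu>} =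
    card {t \<in> valued_trees m n. Q t}"
proof -
  note bij = bij_betw_relabel[of n m]
  have "bij_betw (\<lambda>(\<phi>, \<nu>). relabel \<nu> \<phi>) 
     {(\<phi>, \<nu>). \<phi> \<in> bracketings n \<and> \<nu> \<in> valuations m n \<and> P \<phi> \<nu>} {t \<in> valued_trees m n. Q t}"
  proof (rule bij_betw_subset[OF bij])
    have "{t \<in> valued_trees m n. Q t} = {t \<in> (\<lambda>(\<phi>, \<nu>). relabel \<nu> \<phi>) ` (bracketings n \<times> valuations m n). Q t}"
      using bij_betw_imp_surj_on[OF bij] by simp
    also have "\<dots> = (\<lambda>(\<phi>, \<nu>). relabel \<nu> \<phi>) ` {(\<phi>, \<nu>). \<phi> \<in> bracketings n \<and> \<nu> \<in> valuations m n \<and> P \<phi> \<nu>}"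
      using assms by auto
    finally show "(\<lambda>(\<phi>, \<nu>). relabel \<nu> \<phi>) ` {(\<phi>, \<nu>). \<phi> \<in> bracketings n \<and> \<nu> \<in> valuations m n \<and> P \<phi> \<nu>}
       = {t \<in> valued_trees m n. Q t}" ..
  qed auto
  then show ?thesis by (rule bij_betw_same_card)
qed

lemma g_count_eq: "g_count m k n = card (valued_trees_at m k n)"
  unfolding g_count_def valued_trees_at_def
  by (rule card_bracketings_valuations) (simp add: truth_value_relabel)

lemma N_count_eq:
  "N_count m i j n = card {t \<in> valued_trees m n. 
     \<exists>\<phi> \<psi>. t = Imp \<phi> \<psi> \<and> truth_value m id \<phi> = i \<and> truth_value m id \<psi> = j}"
  unfolding N_count_def
proof (rule card_bracketings_valuations)
  fix \<phi> \<nu>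
  show "(\<exists>\<phi>' \<psi>. \<phi> = Imp \<phi>' \<psi> \<and> truth_value m \<nu> \<phi>' = i \<and> truth_value m \<nu> \<psi> = j) \<longleftrightarrow>
    (\<exists>\<phi>' \<psi>. relabel \<nu> \<phi> = Imp \<phi>' \<psi> \<and> truth_value m id \<phi>' = i \<and> truth_value m id \<psi> = j)"
    by (cases \<phi>) (auto simp: truth_value_relabel)
qed

text \<open>A tree with root \<open>Imp\<close> is a pair of trees, and \<open>l\<close> is the
  number of leaves of the left one. The terms l = 0 and l = n vanish because every tree has a
  leaf.\<close>

lemma N_count_conv: "N_count m i j n = (\<Sum>l\<le>n. g_count m i l * g_count m j (n - l))"
proof -
  have "{t \<in> valued_trees m n. 
     \<exists>\<phi> \<psi>. t = Imp \<phi> \<psi> \<and> truth_value m id \<phi> = i \<and> truth_value m id \<psi> = j} =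
     (\<Union>l\<le>n. (\<lambda>(\<phi>, \<psi>). Imp \<phi> \<psi>) ` (valued_trees_at m i l \<times> valued_trees_at m j (n - l)))"
    (is "?L = (\<Union>l\<le>n. ?R l)")
    by (fastforce simp: valued_trees_def valued_trees_at_def image_iff)
  then have "N_count m i j n = card (\<Union>l\<le>n. ?R l)"
    by (simp add: N_count_eq)
  also have "\<dots> = (\<Sum>l\<le>n. card (?R l))"
  proof (rule card_UN_disjoint)
    show "\<forall>l\<in>{..n}. finite (?R l)"
      by (auto simp: valued_trees_at_def finite_valued_trees)
    show "\<forall>l\<in>{..n}. \<forall>l'\<in>{..n}. l \<noteq> l' \<longrightarrow> ?R l \<inter> ?R l' = {}"
      by (auto simp: valued_trees_at_def valued_trees_def)
  qed auto
  also have "\<dots> = (\<Sum>l\<le>n. g_count m i l * g_count m j (n - l))"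
    by (intro sum.cong refl, subst card_image)
       (auto simp: inj_on_def g_count_eq card_cartesian_product)
  finally show ?thesis .
qed

lemma godel_imp_less: "p < m \<Longrightarrow> q < m \<Longrightarrow> godel_imp m p q < m"
  by (auto simp: godel_imp_def)

lemma truth_value_less: "set (vars t) \<subseteq> {..<m} \<Longrightarrow> truth_value m id t < m"
  by (induction t) (auto simp: godel_imp_less)

text \<open>The trees with value k are the single leaf \<open>Var k\<close>, present only for n = 1,
  and the trees with root \<open>Imp\<close>, sorted by the values (i, j) of the two
  subtrees.\<close>

lemma g_count_rec:
  assumes "k < m"
  shows "g_count m k n = (if n = 1 then 1 else 0) +
    (\<Sum>i<m. \<Sum>j<m. if godel_imp m i j = k then N_count m i j n else 0)"
proof -
  define I where "I = {(i, j). i < m \<and> j < m \<and> godel_imp m i j = k}"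
  define A where "A = (\<lambda>(i, j). {t \<in> valued_trees m n. 
     \<exists>\<phi> \<psi>. t = Imp \<phi> \<psi> \<and> truth_value m id \<phi> = i \<and> truth_value m id \<psi> = j})"
  have I: "finite I" by (rule finite_subset[of _ "{..<m} \<times> {..<m}"]) (auto simp: I_def)
  have A: "finite (A p)" for p
    using finite_valued_trees by (auto simp: A_def split: prod.splits)
  have "valued_trees_at m k n = (if n = 1 then {Var k} else {}) \<union> (\<Union>p\<in>I. A p)" (is "?L = ?V \<union> ?U")
  proof (intro set_eqI)
    fix t
    show "t \<in> ?L \<longleftrightarrow> t \<in> ?V \<union> ?U"
    proof (cases t)
      case (Var x)
      then show ?thesis using assms 
        by (auto simp: valued_trees_at_def valued_trees_def A_def)
    next
      case (Imp a b)
      then show ?thesis using truth_value_less[of a m] truth_value_less[of b m]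
        by (auto simp: valued_trees_at_def valued_trees_def A_def I_def)
    qed
  qed
  then have "g_count m k n = card (?V \<union> ?U)"
    by (simp add: g_count_eq)
  also have "\<dots> = card ?V + card ?U"
    using I A by (intro card_Un_disjoint) (auto simp: A_def)
  also have "card ?U = (\<Sum>p\<in>I. card (A p))"
    using I A by (intro card_UN_disjoint) (auto simp: A_def)
  also have "\<dots> = (\<Sum>(i, j)\<in>I. N_count m i j n)"
    by (intro sum.cong refl) (auto simp: A_def N_count_eq)
  also have "\<dots> = (\<Sum>(i, j)\<in>{..<m} \<times> {..<m}. if godel_imp m i j = k then N_count m i j n else 0)"
    by (intro sum.mono_neutral_cong_left) (auto simp: I_def split: if_splits)
  also have "\<dots> = (\<Sum>i<m. \<Sum>j<m. if godel_imp m i j = k then N_count m i j n else 0)"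
    by (simp add: sum.cartesian_product)
  finally show ?thesis by auto
qed

section \<open>Functional equations of the generating functions\<close>

lemma N_gf_eq: "(N_gf m i j :: 'a :: semiring_1 fps) = G_gf m i * G_gf m j"
  by (rule fps_ext) (simp add: N_gf_def G_gf_def fps_mult_nth N_count_conv atLeast0AtMost)

lemma G_gf_rec:
  assumes "k < m"
  shows "(G_gf m k :: 'a :: semiring_1 fps) =
    fps_X + (\<Sum>i<m. \<Sum>j<m. if godel_imp m i j = k then G_gf m i * G_gf m j else 0)"
proof (rule fps_ext)
  fix n
  have "fps_nth (G_gf m k :: 'a fps) n = of_nat (g_count m k n)"
    by (simp add: G_gf_def)
  also have "\<dots> = (if n = 1 then 1 else 0) +
    (\<Sum>i<m. \<Sum>j<m. if godel_imp m i j = k then of_nat (N_count m i j n) else 0)"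
    by (simp add: g_count_rec[OF assms, of n] if_distrib[of of_nat] cong: if_cong)
  also have "\<dots> = fps_nth (fps_X + (\<Sum>i<m. \<Sum>j<m. 
      if godel_imp m i j = k then N_gf m i j else 0)) n"
    by (simp add: fps_sum_nth N_gf_def if_distrib[of "\<lambda>f. fps_nth f n"] fps_X_def cong: if_cong)
  finally show "fps_nth (G_gf m k :: 'a fps) n = fps_nth (fps_X + 
     (\<Sum>i<m. \<Sum>j<m. if godel_imp m i j = k then G_gf m i * G_gf m j else 0)) n"
    by (simp add: N_gf_eq cong: if_cong)
qed

text \<open>The series \<open>S\<^sub>k\<close> of the overview; it counts the pairs whose value is
  at least v_k.\<close>

definition upper_gf :: "nat \<Rightarrow> nat \<Rightarrow> 'a :: semiring_1 fps" where
  "upper_gf m k = (\<Sum>i\<in>{k..<m}. G_gf m i)"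

lemma upper_gf_Suc: "k < m \<Longrightarrow> upper_gf m k = G_gf m k + upper_gf m (Suc k)"
  by (simp add: upper_gf_def sum.atLeast_Suc_lessThan)

lemma upper_gf_last: "m \<noteq> 0 \<Longrightarrow> upper_gf m (m - 1) = G_gf m (m - 1)"
  by (subst upper_gf_Suc) (auto simp: upper_gf_def)

text \<open>Below the top value, \<open>v\<^sub>i \<Rightarrow>\<^sub>G v\<^sub>j = v\<^sub>k\<close> only if \<open>j = k < i\<close>.\<close>

lemma G_gf_below_top:
  assumes "Suc k < m"
  shows "(G_gf m k :: 'a :: comm_semiring_1 fps) = fps_X + G_gf m k * upper_gf m (Suc k)"
proof -
  have "(\<Sum>i<m. \<Sum>j<m. if godel_imp m i j = k then G_gf m i * G_gf m j else 0)
    = (\<Sum>i<m. \<Sum>j<m. if j = k then (if k < i then G_gf m i * G_gf m k else 0) else (0 :: 'a fps))"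
    using assms by (intro sum.cong refl) (auto simp: godel_imp_def)
  also have "\<dots> = (\<Sum>i<m. if k < i then G_gf m i * G_gf m k else 0)"
    using assms by (simp add: sum.delta)
  also have "\<dots> = (\<Sum>i\<in>{Suc k..<m}. G_gf m i * G_gf m k)"
    by (intro sum.mono_neutral_cong_right) auto
  also have "\<dots> = G_gf m k * upper_gf m (Suc k)"
    by (simp add: upper_gf_def sum_distrib_right [symmetric] mult.commute)
  finally show ?thesis using G_gf_rec[of k m, where ?'a = 'a] assms by simp
qed

text \<open>Each pair (i, j) has exactly one value \<open>godel_imp m i j\<close> below m, so
  summing the recursions over k collects every product G_i G_j once, and the implication drops
  out.\<close>

lemma upper_gf_0:
  "(upper_gf m 0 :: 'a :: comm_semiring_1 fps) = of_nat m * fps_X + upper_gf m 0 * upper_gf m 0"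
proof -
  have "(upper_gf m 0 :: 'a fps) = (\<Sum>k<m. G_gf m k)"
    by (simp add: upper_gf_def atLeast0LessThan)
  also have "\<dots> = (\<Sum>k<m. fps_X + 
     (\<Sum>i<m. \<Sum>j<m. if godel_imp m i j = k then G_gf m i * G_gf m j else 0))"
    by (intro sum.cong refl) (auto intro: G_gf_rec)
  also have "\<dots> = of_nat m * fps_X + 
     (\<Sum>i<m. \<Sum>j<m. \<Sum>k<m. if godel_imp m i j = k then G_gf m i * G_gf m j else 0)"
    unfolding sum.distrib
    by (subst sum.swap, subst (2) sum.swap) simp
  also have "(\<Sum>i<m. \<Sum>j<m. \<Sum>k<m. if godel_imp m i j = k then G_gf m i * G_gf m j else (0 :: 'a fps))
    = (\<Sum>i<m. \<Sum>j<m. G_gf m i * G_gf m j)"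
    by (intro sum.cong refl) (auto simp: godel_imp_less)
  also have "\<dots> = upper_gf m 0 * upper_gf m 0"
    by (simp add: upper_gf_def atLeast0LessThan sum_product)
  finally show ?thesis .
qed

section \<open>Convolutions of sequences of order \<open>n\<^bsup>-3/2\<^esup>\<close>\<close>

text \<open>Tannery's theorem: for fixed j the factor z (n - j) tends to \<zeta>, and K |w j|
  dominates the terms, with K a bound on |z|.\<close>

lemma convolution_tendsto:
  fixes w z :: "nat \<Rightarrow> real"
  assumes w: "summable (\<lambda>n. \<bar>w n\<bar>)" and z: "z \<longlonglongrightarrow> \<zeta>"
  shows "(\<lambda>n. \<Sum>j\<le>n. w j * z (n - j)) \<longlonglongrightarrow> \<zeta> * suminf w"
proof -
  define a where "a = (\<lambda>k n. if k \<le> n then w k * z (n - k) else 0)"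
  obtain K where K: "\<And>n. \<bar>z n\<bar> \<le> K"
    using convergent_imp_Bseq[of z] z by (auto simp: convergent_def Bseq_def)
  have K0: "K \<ge> 0" using K[of 0] by linarith
  have "(\<lambda>n. suminf (\<lambda>k. a k n)) \<longlonglongrightarrow> suminf (\<lambda>k. w k * \<zeta>)"
  proof (rule tannerys_theorem[where M = "\<lambda>k. \<bar>w k\<bar> * K", THEN conjunct2, THEN conjunct2])
    fix k
    have "(\<lambda>n. w k * z (n - k)) \<longlonglongrightarrow> w k * \<zeta>"
      by (intro tendsto_intros filterlim_compose[OF z] filterlim_minus_const_nat_at_top)
    moreover have "eventually (\<lambda>n. w k * z (n - k) = a k n) sequentially"
      using eventually_ge_at_top[of k] by eventually_elim (simp add: a_def)
    ultimately show "(\<lambda>n. a k n) \<longlonglongrightarrow> w k * \<zeta>"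
      by (rule Lim_transform_eventually)
  next
    show "\<forall>\<^sub>F (k, n) in sequentially \<times>\<^sub>F sequentially. norm (a k n) \<le> \<bar>w k\<bar> * K"
      using K K0 by (intro always_eventually) (auto simp: a_def abs_mult intro!: mult_left_mono)
  qed (use w in \<open>auto intro: summable_mult2\<close>)
  moreover have "suminf (\<lambda>k. a k n) = (\<Sum>j\<le>n. w j * z (n - j))" for n
    by (subst suminf_finite[of "{..n}"]) (auto simp: a_def)
  moreover have "suminf (\<lambda>k. w k * \<zeta>) = \<zeta> * suminf w"
    using suminf_mult2[of w \<zeta>] summable_rabs_cancel[OF w] by (simp add: mult.commute)
  ultimately show ?thesis by simp
qed

text \<open>Let e = y - \<zeta> and let L be the limit superior of |e|, finite because y is bounded.
  The recurrence gives L \<le> L q with q the sum of all |w j|; since q < 1, L = 0.\<close>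

lemma contraction_tendsto:
  fixes y w :: "nat \<Rightarrow> real"
  assumes y: "\<And>n. \<bar>y n\<bar> \<le> K"
    and w: "summable (\<lambda>n. \<bar>w n\<bar>)" "(\<Sum>n. \<bar>w n\<bar>) < 1"
    and c: "(\<lambda>n. y n - (\<Sum>j\<le>n. w j * y (n - j))) \<longlonglongrightarrow> c"
  shows "y \<longlonglongrightarrow> c / (1 - suminf w)"
proof -
  define q where "q = (\<Sum>n. \<bar>w n\<bar>)"
  \<comment> \<open>The only candidate: a limit has to satisfy \<zeta> = c + \<zeta> * suminf
    w.\<close>
  define \<zeta> where "\<zeta> = c / (1 - suminf w)"
  define e where "e = (\<lambda>n. y n - \<zeta>)"
  define \<eta> where "\<eta> = (\<lambda>n. \<bar>e n - (\<Sum>j\<le>n. w j * e (n - j))\<bar>)"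
  \<comment> \<open>The tail suprema decrease to the limit superior. Unlike |e| they are known to
    converge, so \<open>convolution_tendsto\<close> applies to them.\<close>
  define M where "M = (\<lambda>N. SUP n\<in>{N..}. \<bar>e n\<bar>)"
  have W: "suminf w < 1"
    using w summable_rabs[OF w(1)] by linarith
  have \<zeta>_W: "\<zeta> * (1 - suminf w) = c"
    using W by (simp add: \<zeta>_def)
  have sw: "(\<lambda>n. \<Sum>j\<le>n. w j) \<longlonglongrightarrow> suminf w"
    using summable_LIMSEQ'[OF summable_rabs_cancel[OF w(1)]] .
  have "(\<lambda>n. (y n - (\<Sum>j\<le>n. w j * y (n - j))) - (\<zeta> - \<zeta> * (\<Sum>j\<le>n. w j))) \<longlonglongrightarrow> c - (\<zeta> - \<zeta> * suminf w)"
    by (intro tendsto_intros c sw)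
  also have "c - (\<zeta> - \<zeta> * suminf w) = 0"
    using \<zeta>_W by (simp add: algebra_simps)
  also have "(\<lambda>n. (y n - (\<Sum>j\<le>n. w j * y (n - j))) - (\<zeta> - \<zeta> * (\<Sum>j\<le>n. w j))) =
      (\<lambda>n. e n - (\<Sum>j\<le>n. w j * e (n - j)))"
    by (simp add: e_def algebra_simps sum_subtractf sum_distrib_left)
  finally have \<eta>: "\<eta> \<longlonglongrightarrow> 0"
    unfolding \<eta>_def by (rule tendsto_rabs_zero)
  have e_le: "\<bar>e n\<bar> \<le> K + \<bar>\<zeta>\<bar>" for n
    using y[of n] by (auto simp: e_def)
  have bdd: "bdd_above ((\<lambda>n. \<bar>e n\<bar>) ` A)" for A
    by (rule bdd_aboveI2[of _ _ "K + \<bar>\<zeta>\<bar>"]) (rule e_le)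
  have e_M: "\<bar>e n\<bar> \<le> M N" if "N \<le> n" for n N
    unfolding M_def using that by (intro cSUP_upper bdd) auto
  have M0: "0 \<le> M N" for N
    using e_M[of N N] by linarith
  have "decseq M"
    unfolding M_def by (intro decseq_SucI cSUP_subset_mono bdd) auto
  then obtain L where L: "M \<longlonglongrightarrow> L" "\<And>N. L \<le> M N"
    using decseq_convergent[of M 0] M0 by blast
  have L0: "0 \<le> L" using LIMSEQ_le_const[OF L(1)] M0 by blast
  define Z where "Z = (\<lambda>n. \<eta> n + (\<Sum>j\<le>n. \<bar>w j\<bar> * M (n - j)))"
  have eZ: "\<bar>e n\<bar> \<le> Z n" for n
  proof -
    have "\<bar>\<Sum>j\<le>n. w j * e (n - j)\<bar> \<le> (\<Sum>j\<le>n. \<bar>w j * e (n - j)\<bar>)" by (rule sum_abs)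
    also have "\<dots> \<le> (\<Sum>j\<le>n. \<bar>w j\<bar> * M (n - j))"
      by (intro sum_mono) (auto simp: abs_mult intro!: mult_left_mono e_M)
    finally show ?thesis unfolding Z_def \<eta>_def by linarith
  qed
  have "Z \<longlonglongrightarrow> 0 + L * q"
    unfolding Z_def q_def using w(1) by (intro tendsto_add \<eta> convolution_tendsto L(1)) simp
  then have Z: "Z \<longlonglongrightarrow> L * q" by simp
  have "L \<le> L * q"
  proof (rule field_le_epsilon)
    fix \<epsilon> :: real assume "\<epsilon> > 0"
    then have "eventually (\<lambda>n. Z n < L * q + \<epsilon>) sequentially"
      using order_tendstoD(2)[OF Z] by simp
    then obtain N where N: "\<And>n. n \<ge> N \<Longrightarrow> Z n < L * q + \<epsilon>"
      by (auto simp: eventually_at_top_linorder)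
    have "M N \<le> L * q + \<epsilon>"
      unfolding M_def
    proof (rule cSUP_least)
      fix n assume "n \<in> {N..}"
      then show "\<bar>e n\<bar> \<le> L * q + \<epsilon>" using N[of n] eZ[of n] by simp
    qed simp
    then show "L \<le> L * q + \<epsilon>" using L(2)[of N] by linarith
  qed
  moreover have "L * q < L" if "L > 0" using that w(2) by (simp add: q_def)
  ultimately have "L = 0" using L0 by fastforce
  have "e \<longlonglongrightarrow> 0"
    by (rule tendsto_rabs_zero_cancel, rule tendsto_sandwich[OF _ _ tendsto_const])
       (use L(1) \<open>L = 0\<close> e_M in auto)
  then have "(\<lambda>n. e n + \<zeta>) \<longlonglongrightarrow> 0 + \<zeta>" by (intro tendsto_intros)
  then show ?thesis by (simp add: e_def \<zeta>_def)
qed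

section \<open>The weight n^(3/2) and its failure to be additive\<close>

definition wt :: "nat \<Rightarrow> real" where "wt n = real n powr (3/2)"

lemma wt_nonneg [simp]: "0 \<le> wt n" by (simp add: wt_def)

lemma wt_mono: "j \<le> n \<Longrightarrow> wt j \<le> wt n"
  unfolding wt_def by (intro powr_mono2) auto

text \<open>Of j and n - j one is at least n/2, and its weight is then comparable to that of n; 4 is
  a round bound for 2^(3/2).\<close>

lemma wt_double: 
  assumes "n \<le> 2 * l" shows "wt n \<le> 4 * wt l"
proof -
  have "wt n \<le> wt (2 * l)" by (rule wt_mono[OF assms])
  also have "\<dots> = 2 powr (3/2) * wt l" by (simp add: wt_def powr_mult)
  also have "\<dots> \<le> 2 powr 2 * wt l" by (intro mult_right_mono powr_mono) auto
  finally show ?thesis by simp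
qed

text \<open>Comparison with the series of C n^(-3/2), from n = 1 on: \<open>wt 0 = 0\<close> leaves
  u 0 uncontrolled.\<close>

lemma summable_of_wt_bound:
  assumes "\<And>n. \<bar>u n * wt n\<bar> \<le> C"
  shows "summable (\<lambda>n. \<bar>u n :: real\<bar>)"
proof (rule summable_comparison_test')
  show "summable (\<lambda>n. C * real n powr (-3/2))"
    by (intro summable_mult) (simp add: summable_real_powr_iff)
  fix n :: nat assume "n \<ge> 1"
  then have "norm \<bar>u n\<bar> = \<bar>u n * wt n\<bar> * real n powr (-3/2)"
    by (simp add: abs_mult wt_def powr_minus)
  also have "\<dots> \<le> C * real n powr (-3/2)"
    by (intro mult_right_mono assms) auto
  finally show "norm \<bar>u n\<bar> \<le> C * real n powr (-3/2)" .
qed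

text \<open>Were \<open>wt\<close> additive, weighting would be an exact derivation on convolutions.
  This is the error made at the split of n into j and n - j.\<close>

definition wt_defect :: "nat \<Rightarrow> nat \<Rightarrow> real" where
  "wt_defect n j = \<bar>wt n - wt j - wt (n - j)\<bar>"

lemma wt_defect_le: "j \<le> n \<Longrightarrow> wt_defect n j \<le> wt n"
  using wt_mono[of j n] wt_mono[of "n - j" n] wt_nonneg[of j] wt_nonneg[of "n - j"]
  unfolding wt_defect_def by linarith

text \<open>For fixed j, both wt j and wt n - wt (n - j) are of smaller order than wt n.\<close>

lemma wt_defect_ratio: "(\<lambda>n. wt_defect n j / wt n) \<longlonglongrightarrow> 0"
proof -
  have "(\<lambda>n. (real n - real j) powr (3/2) / real n powr (3/2)) \<longlonglongrightarrow> 1"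
       "(\<lambda>n. wt j / real n powr (3/2)) \<longlonglongrightarrow> 0"
    by real_asymp+
  then have "(\<lambda>n. \<bar>1 - wt j / real n powr (3/2) - (real n - real j) powr (3/2) / real n powr (3/2)\<bar>) \<longlonglongrightarrow> \<bar>1 - 0 - 1\<bar>"
    by (intro tendsto_intros)
  then have "(\<lambda>n. \<bar>1 - wt j / real n powr (3/2) - (real n - real j) powr (3/2) / real n powr (3/2)\<bar>) \<longlonglongrightarrow> 0"
    by simp
  moreover have "eventually (\<lambda>n. \<bar>1 - wt j / real n powr (3/2) - (real n - real j) powr (3/2) / real n powr (3/2)\<bar>
     = wt_defect n j / wt n) sequentially"
    using eventually_ge_at_top[of "Suc j"]
  proof eventually_elim
    case (elim n)
    then have "wt n > 0" by (simp add: wt_def)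
    then have "wt_defect n j / wt n = \<bar>(wt n - wt j - wt (n - j)) / wt n\<bar>"
      by (simp add: wt_defect_def)
    also have "(wt n - wt j - wt (n - j)) / wt n = 1 - wt j / wt n - wt (n - j) / wt n"
      using \<open>wt n > 0\<close> by (simp add: diff_divide_distrib)
    finally show ?case using elim by (simp add: wt_def of_nat_diff)
  qed
  ultimately show ?thesis by (rule Lim_transform_eventually)
qed

text \<open>Tannery's theorem again: each term tends to 0, and |u j| dominates it since the defect
  never exceeds wt n.\<close>

lemma sum_wt_defect_tendsto:
  assumes u: "summable (\<lambda>n. \<bar>u n :: real\<bar>)"
  shows "(\<lambda>n. \<Sum>j\<le>n. \<bar>u j\<bar> * (wt_defect n j / wt n)) \<longlonglongrightarrow> 0"
proof -
  define a where "a = (\<lambda>j n. if j \<le> n then \<bar>u j\<bar> * (wt_defect n j / wt n) else 0)"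
  have "(\<lambda>n. suminf (\<lambda>j. a j n)) \<longlonglongrightarrow> suminf (\<lambda>j. 0)"
  proof (rule tannerys_theorem[where M = "\<lambda>j. \<bar>u j\<bar>", THEN conjunct2, THEN conjunct2])
    fix j
    have "(\<lambda>n. \<bar>u j\<bar> * (wt_defect n j / wt n)) \<longlonglongrightarrow> 0"
      by (rule tendsto_mult_right_zero[OF wt_defect_ratio])
    moreover have "eventually (\<lambda>n. \<bar>u j\<bar> * (wt_defect n j / wt n) = a j n) sequentially"
      using eventually_ge_at_top[of j] by eventually_elim (simp add: a_def)
    ultimately show "(\<lambda>n. a j n) \<longlonglongrightarrow> 0"
      by (rule Lim_transform_eventually)
  next
    have "norm (a j n) \<le> \<bar>u j\<bar>" for j n
    proof (cases "j \<le> n")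
      case True
      \<comment> \<open>For n = 0 the quotient is 0, because division by zero yields 0.\<close>
      have "0 \<le> wt_defect n j / wt n" "wt_defect n j / wt n \<le> 1"
        using wt_defect_le[OF True] by (auto simp: wt_defect_def divide_le_eq_1 less_le)
      then have "\<bar>\<bar>u j\<bar> * (wt_defect n j / wt n)\<bar> \<le> \<bar>u j\<bar> * 1"
        unfolding abs_mult by (intro mult_mono) auto
      then show ?thesis using True by (simp add: a_def)
    qed (simp add: a_def)
    then show "\<forall>\<^sub>F (j, n) in sequentially \<times>\<^sub>F sequentially. norm (a j n) \<le> \<bar>u j\<bar>"
      by (intro always_eventually) auto
  qed (use u in auto)
  moreover have "suminf (\<lambda>j. a j n) = (\<Sum>j\<le>n. \<bar>u j\<bar> * (wt_defect n j / wt n))" for n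
    by (subst suminf_finite[of "{..n}"]) (auto simp: a_def)
  ultimately show ?thesis by simp
qed

lemma sum_atMost_rev: "(\<Sum>j\<le>n. f (n - j)) = (\<Sum>j\<le>(n::nat). f j)"
  using sum.nat_diff_reindex[of f "Suc n"] by (simp add: lessThan_Suc_atMost)

text \<open>In a convolution of two \<open>O(n\<^bsup>-3/2\<^esup>)\<close> sequences only the terms with one small index
  matter, so multiplication by \<open>n\<^bsup>3/2\<^esup>\<close> acts as a derivation up to \<open>o(1)\<close>.\<close>

lemma convolution_wt:
  fixes u v :: "nat \<Rightarrow> real"
  assumes u: "\<And>n. \<bar>u n * wt n\<bar> \<le> C" and v: "\<And>n. \<bar>v n * wt n\<bar> \<le> C"
  shows "(\<lambda>n. (\<Sum>j\<le>n. u j * v (n - j)) * wt n - 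
     (\<Sum>j\<le>n. u j * (v (n - j) * wt (n - j))) - (\<Sum>j\<le>n. v j * (u (n - j) * wt (n - j)))) \<longlonglongrightarrow> 0"
    (is "?D \<longlonglongrightarrow> 0")
proof -
  define E where "E = (\<lambda>u n. \<Sum>j\<le>n. \<bar>u j :: real\<bar> * (wt_defect n j / wt n))"
  have "(\<lambda>n. 4 * C * (E u n + E v n)) \<longlonglongrightarrow> 4 * C * (0 + 0)"
    unfolding E_def by (intro tendsto_intros sum_wt_defect_tendsto)
       (rule summable_of_wt_bound, rule u v)+
  moreover have "\<forall>\<^sub>F n in sequentially. norm (?D n) \<le> 4 * C * (E u n + E v n)"
    using eventually_gt_at_top[of 0]
  proof eventually_elim
    case (elim n)
    then have wt: "wt n > 0" by (simp add: wt_def)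
    \<comment> \<open>An entry whose index is at least n/2 is already of size 4 C / wt n.\<close>
    have *: "\<bar>x l\<bar> \<le> 4 * C / wt n" if x: "\<And>n. \<bar>x n * wt n\<bar> \<le> C" and "n \<le> 2 * l" for x l
    proof -
      have "\<bar>x l\<bar> * wt n \<le> \<bar>x l\<bar> * (4 * wt l)"
        by (intro mult_left_mono wt_double that) auto
      also have "\<dots> \<le> 4 * C" using x[of l] by (simp add: abs_mult)
      finally show ?thesis using wt by (simp add: field_simps)
    qed
    \<comment> \<open>Reversing the second convolution aligns the factors, so every term of the
      difference becomes u j * v (n - j) times the signed defect.\<close>
    have "(\<Sum>j\<le>n. v j * (u (n - j) * wt (n - j))) = (\<Sum>j\<le>n. v (n - j) * (u j * wt j))"
      by (subst sum_atMost_rev[symmetric]) simp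
    then have "?D n = (\<Sum>j\<le>n. u j * v (n - j) * wt n - u j * (v (n - j) * wt (n - j)) - v (n - j) * (u j * wt j))"
      by (simp only: sum_distrib_right sum_subtractf)
    also have "\<dots> = (\<Sum>j\<le>n. u j * v (n - j) * (wt n - wt j - wt (n - j)))"
      by (intro sum.cong refl) (simp add: algebra_simps)
    finally have "?D n = (\<Sum>j\<le>n. u j * v (n - j) * (wt n - wt j - wt (n - j)))" .
    then have "norm (?D n) \<le> (\<Sum>j\<le>n. \<bar>u j * v (n - j) * (wt n - wt j - wt (n - j))\<bar>)"
      by (simp only: real_norm_def sum_abs)
    also have "\<dots> = (\<Sum>j\<le>n. \<bar>u j\<bar> * \<bar>v (n - j)\<bar> * wt_defect n j)"
      by (simp add: abs_mult wt_defect_def)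
    also have "\<dots> \<le> (\<Sum>j\<le>n. 4 * C * (\<bar>u j\<bar> * (wt_defect n j / wt n)) + 
                           4 * C * (\<bar>v (n - j)\<bar> * (wt_defect n (n - j) / wt n)))"
    proof (rule sum_mono)
      fix j assume "j \<in> {..n}"
      then have sym: "wt_defect n (n - j) = wt_defect n j" by (simp add: wt_defect_def algebra_simps)
      have nn: "0 \<le> wt_defect n j" "C \<ge> 0" using u[of 0] by (auto simp: wt_defect_def)
      \<comment> \<open>The entry with the larger index takes the bound 4 C / wt n; the other keeps
        its absolute value, to be summed against the defect ratio.\<close>
      have "n \<le> 2 * (n - j) \<or> n \<le> 2 * j" by linarith
      then have "\<bar>u j\<bar> * \<bar>v (n - j)\<bar> * wt_defect n j \<le> \<bar>u j\<bar> * (4 * C / wt n) * wt_defect n j \<or>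
         \<bar>u j\<bar> * \<bar>v (n - j)\<bar> * wt_defect n j \<le> (4 * C / wt n) * \<bar>v (n - j)\<bar> * wt_defect n j"
      proof
        assume "n \<le> 2 * (n - j)"
        then show ?thesis using nn
          by (intro disjI1 mult_right_mono mult_left_mono *[of v, OF v]) auto
      next
        assume "n \<le> 2 * j"
        then show ?thesis using nn
          by (intro disjI2 mult_right_mono *[of u, OF u]) auto
      qed
      moreover have "0 \<le> (4 * C / wt n) * \<bar>v (n - j)\<bar> * wt_defect n j" "0 \<le> \<bar>u j\<bar> * (4 * C / wt n) * wt_defect n j"
        using nn by auto
      moreover have eqs: "4 * C * (\<bar>u j\<bar> * (wt_defect n j / wt n)) = \<bar>u j\<bar> * (4 * C / wt n) * wt_defect n j"
        "4 * C * (\<bar>v (n - j)\<bar> * (wt_defect n j / wt n)) = (4 * C / wt n) * \<bar>v (n - j)\<bar> * wt_defect n j"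
        by simp_all
      ultimately show "\<bar>u j\<bar> * \<bar>v (n - j)\<bar> * wt_defect n j \<le> 4 * C * (\<bar>u j\<bar> * (wt_defect n j / wt n)) + 
                           4 * C * (\<bar>v (n - j)\<bar> * (wt_defect n (n - j) / wt n))"
        unfolding sym eqs by (elim disjE) linarith+
    qed
    also have "\<dots> = 4 * C * E u n + 4 * C * (\<Sum>j\<le>n. \<bar>v (n - j)\<bar> * (wt_defect n (n - j) / wt n))"
      by (simp only: E_def sum.distrib sum_distrib_left)
    also have "(\<Sum>j\<le>n. \<bar>v (n - j)\<bar> * (wt_defect n (n - j) / wt n)) = E v n"
      unfolding E_def by (rule sum_atMost_rev)
    finally show ?case by (simp add: algebra_simps)
  qed
  ultimately show ?thesis
    by (intro Lim_null_comparison[of ?D]) simp_all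
qed

section \<open>Power series with a square-root singularity\<close>

lemma expansion_diff:
  fixes f g s :: "'a \<Rightarrow> real"
  assumes "(\<lambda>x. f x - (a - b * s x)) \<in> O[F](\<lambda>x. (s x)\<^sup>2)"
    and "(\<lambda>x. g x - (a' - b' * s x)) \<in> O[F](\<lambda>x. (s x)\<^sup>2)"
  shows "(\<lambda>x. (f x - g x) - ((a - a') - (b - b') * s x)) \<in> O[F](\<lambda>x. (s x)\<^sup>2)"
  using sum_in_bigo(2)[OF assms] by (simp add: algebra_simps)

lemma expansion_bounded:
  fixes f s :: "'a \<Rightarrow> real"
  assumes s: "s \<in> O[F](\<lambda>_. 1)" and f: "(\<lambda>x. f x - (a - b * s x)) \<in> O[F](\<lambda>x. (s x)\<^sup>2)"
  shows "(\<lambda>x. f x - a) \<in> O[F](s)" "f \<in> O[F](\<lambda>_. 1)"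
proof -
  have "(\<lambda>x. s x * s x) \<in> O[F](\<lambda>x. s x * 1)"
    by (intro landau_o.big.mult s) auto
  then have "(\<lambda>x. (s x)\<^sup>2) \<in> O[F](s)" by (simp add: power2_eq_square)
  then have 1: "(\<lambda>x. f x - (a - b * s x)) \<in> O[F](s)"
    using f landau_o.big.trans by blast
  have "(\<lambda>x. (f x - (a - b * s x)) - b * s x) \<in> O[F](s)"
    by (intro sum_in_bigo 1) auto
  then show *: "(\<lambda>x. f x - a) \<in> O[F](s)" by (simp add: algebra_simps)
  have "(\<lambda>x. (f x - a) + a) \<in> O[F](\<lambda>_. 1)"
    by (intro sum_in_bigo landau_o.big.trans[OF * s]) auto
  then show "f \<in> O[F](\<lambda>_. 1)" by simp
qed

lemma expansion_mult:
  fixes f g s :: "'a \<Rightarrow> real"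
  assumes s: "s \<in> O[F](\<lambda>_. 1)"
    and f: "(\<lambda>x. f x - (a - b * s x)) \<in> O[F](\<lambda>x. (s x)\<^sup>2)"
    and g: "(\<lambda>x. g x - (a' - b' * s x)) \<in> O[F](\<lambda>x. (s x)\<^sup>2)"
  shows "(\<lambda>x. f x * g x - (a * a' - (a * b' + a' * b) * s x)) \<in> O[F](\<lambda>x. (s x)\<^sup>2)"
proof -
  have "(\<lambda>x. (f x - (a - b * s x)) * g x) \<in> O[F](\<lambda>x. (s x)\<^sup>2 * 1)"
    by (intro landau_o.big.mult f expansion_bounded(2)[OF s g])
  moreover have "(\<lambda>x. (a - b * s x) * (g x - (a' - b' * s x))) \<in> O[F](\<lambda>x. 1 * (s x)\<^sup>2)"
    using s by (intro landau_o.big.mult g sum_in_bigo) auto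
  \<comment> \<open>The product of the two linear parts leaves this term, which the error
    absorbs.\<close>
  moreover have "(\<lambda>x. b * b' * (s x)\<^sup>2) \<in> O[F](\<lambda>x. (s x)\<^sup>2)" by simp
  ultimately have "(\<lambda>x. (f x - (a - b * s x)) * g x + (a - b * s x) * (g x - (a' - b' * s x)) + b * b' * (s x)\<^sup>2)
    \<in> O[F](\<lambda>x. (s x)\<^sup>2)"
    by (intro sum_in_bigo) auto
  then show ?thesis by (simp add: algebra_simps power2_eq_square)
qed

text \<open>Subtracting the equation for the limit a gives (f - a) D = h - a p1 s with D at least 1
  - p0 > 0, hence f - a = O(s). A second pass replaces D by its limit E at the cost of a product of
  two O(s) terms, and this fixes the coefficient of s.\<close>

lemma expansion_quadratic:
  fixes f p s :: "'a \<Rightarrow> real"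
  assumes s: "s \<in> O[F](\<lambda>_. 1)"
    and p: "(\<lambda>x. p x - (p0 - p1 * s x)) \<in> O[F](\<lambda>x. (s x)\<^sup>2)"
    and eq: "eventually (\<lambda>x. f x * (1 - p x + f x) = r * (1 - (s x)\<^sup>2)) F"
    and a: "a * (1 - p0 + a) = r" "0 \<le> a" "p0 < 1"
    and pos: "eventually (\<lambda>x. 0 \<le> f x \<and> p x \<le> p0) F"
  shows "(\<lambda>x. f x - (a - p1 * a / (1 - p0 + 2 * a) * s x)) \<in> O[F](\<lambda>x. (s x)\<^sup>2)"
proof -
  define E where "E = 1 - p0 + 2 * a"
  have E: "E > 0" using a by (simp add: E_def)
  define D where "D = (\<lambda>x. f x + a + 1 - p x)"
  define h where "h = (\<lambda>x. a * (p x - (p0 - p1 * s x)) - r * (s x)\<^sup>2)"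
  have h: "h \<in> O[F](\<lambda>x. (s x)\<^sup>2)" unfolding h_def
    using p by (intro sum_in_bigo) auto
  have key: "eventually (\<lambda>x. (f x - a) * D x = h x - a * p1 * s x) F"
    using eq
  proof eventually_elim
    case (elim x)
    have "(f x - a) * D x = f x * (1 - p x + f x) - a * (1 - p0 + a) + a * (p x - p0)"
      by (simp add: D_def algebra_simps)
    then show ?case unfolding elim a(1) h_def by (simp add: algebra_simps)
  qed
  have ss: "(\<lambda>x. (s x)\<^sup>2) \<in> O[F](s)"
    using landau_o.big.mult[OF s landau_o.big_refl[of s]] by (simp add: power2_eq_square)
  have hs: "(\<lambda>x. h x - a * p1 * s x) \<in> O[F](s)"
    using landau_o.big.trans[OF h ss] by (intro sum_in_bigo) auto
  have "eventually (\<lambda>x. norm (f x - a) \<le> 1 / (1 - p0) * norm (h x - a * p1 * s x)) F"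
    using key pos
  proof eventually_elim
    case (elim x)
    have "1 - p0 \<le> D x" using elim a by (simp add: D_def)
    then have "\<bar>f x - a\<bar> * (1 - p0) \<le> \<bar>f x - a\<bar> * \<bar>D x\<bar>"
      by (intro mult_left_mono) auto
    also have "\<dots> = \<bar>h x - a * p1 * s x\<bar>" using elim by (simp add: abs_mult [symmetric])
    finally show ?case using a by (simp add: field_simps)
  qed
  then have fa: "(\<lambda>x. f x - a) \<in> O[F](s)"
    by (intro landau_o.big.trans[OF bigoI hs])
  \<comment> \<open>Second pass: the function in question is E - D.\<close>
  have "(\<lambda>x. (p x - p0) - (f x - a)) \<in> O[F](s)"
    by (intro sum_in_bigo fa expansion_bounded(1)[OF s p])
  then have "(\<lambda>x. (f x - a) * ((p x - p0) - (f x - a))) \<in> O[F](\<lambda>x. s x * s x)"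
    by (intro landau_o.big.mult fa)
  then have "(\<lambda>x. (f x - a) * ((p x - p0) - (f x - a)) + h x) \<in> O[F](\<lambda>x. (s x)\<^sup>2)"
    unfolding power2_eq_square [symmetric] by (intro sum_in_bigo h)
  also have "?this \<longleftrightarrow> (\<lambda>x. E * (f x - (a - p1 * a / E * s x))) \<in> O[F](\<lambda>x. (s x)\<^sup>2)"
  proof (rule landau_o.big.in_cong)
    show "eventually (\<lambda>x. (f x - a) * ((p x - p0) - (f x - a)) + h x = E * (f x - (a - p1 * a / E * s x))) F"
      using key
    proof eventually_elim
      case (elim x)
      have "(f x - a) * ((p x - p0) - (f x - a)) = (f x - a) * (E - D x)"
        by (simp add: D_def E_def)
      also have "\<dots> = (f x - a) * E - (h x - a * p1 * s x)"
        using elim by (simp add: right_diff_distrib)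
      finally have "(f x - a) * ((p x - p0) - (f x - a)) + h x = (f x - a) * E + a * p1 * s x"
        by simp
      also have "\<dots> = E * (f x - (a - p1 * a / E * s x))"
        using E by (simp add: field_simps)
      finally show ?case .
    qed
  qed
  finally show ?thesis using E by (simp add: E_def)
qed

text \<open>Value at r, coefficient limit and expansion at r are carried side by side with shared
  constants, instead of deducing the coefficients from the expansion. The factor 1 / (2 sqrt pi) is
  - 1 / Gamma (-1/2), which belongs to the coefficients of - sqrt (1 - x/r).\<close>

definition sqrt_type :: "real \<Rightarrow> real fps \<Rightarrow> real \<Rightarrow> real \<Rightarrow> bool" where
  "sqrt_type r f a b \<longleftrightarrow>
     (\<lambda>n. fps_nth f n * r ^ n) sums a \<and>
     (\<lambda>n. fps_nth f n * r ^ n * wt n) \<longlonglongrightarrow> b / (2 * sqrt pi) \<and>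
     (\<lambda>x. eval_fps f x - (a - b * sqrt (1 - x / r))) \<in> O[at_left r](\<lambda>x. (sqrt (1 - x / r))\<^sup>2)"

section \<open>Closure under difference, product and the quadratic equation\<close>

lemma sqrt_type_bound:
  assumes "sqrt_type r f a b"
  obtains C where "\<And>n. \<bar>fps_nth f n * r ^ n * wt n\<bar> \<le> C"
proof -
  have "Bseq (\<lambda>n. fps_nth f n * r ^ n * wt n)"
    using assms by (intro convergent_imp_Bseq convergentI) (auto simp: sqrt_type_def)
  then show ?thesis using that by (auto simp: Bseq_def)
qed

lemma sqrt_type_summable:
  assumes "sqrt_type r f a b"
  shows "summable (\<lambda>n. \<bar>fps_nth f n * r ^ n\<bar>)"
proof -
  obtain C where "\<And>n. \<bar>fps_nth f n * r ^ n * wt n\<bar> \<le> C"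
    using sqrt_type_bound[OF assms] by blast
  then show ?thesis by (rule summable_of_wt_bound)
qed

lemma sqrt_type_suminf: "sqrt_type r f a b \<Longrightarrow> (\<Sum>n. fps_nth f n * r ^ n) = a"
  by (simp add: sqrt_type_def sums_iff)

lemma fps_conv_radius_ge:
  fixes f :: "real fps"
  assumes "summable (\<lambda>n. fps_nth f n * r ^ n)" "r > 0"
  shows "fps_conv_radius f \<ge> ereal r"
  using conv_radius_geI[OF assms(1)] assms(2) by (simp add: fps_conv_radius_def)

lemma sqrt_type_conv_radius: "sqrt_type r f a b \<Longrightarrow> r > 0 \<Longrightarrow> fps_conv_radius f \<ge> ereal r"
  by (rule fps_conv_radius_ge) (auto simp: sqrt_type_def sums_iff)

lemma eventually_at_left_pos: "r > 0 \<Longrightarrow> eventually (\<lambda>x. 0 < x \<and> x < (r :: real)) (at_left r)"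
  using eventually_at_left_real[of 0 r] by simp

lemma sqrt_bounded:
  assumes "r > 0"
  shows "(\<lambda>x. sqrt (1 - x / r)) \<in> O[at_left r](\<lambda>_. 1)"
proof (rule bigoI[where c = 1])
  show "eventually (\<lambda>x. norm (sqrt (1 - x / r)) \<le> 1 * norm (1 :: real)) (at_left r)"
    using eventually_at_left_pos[OF assms] by eventually_elim auto
qed

lemma norm_less_conv_radius:
  "x < r \<Longrightarrow> 0 < x \<Longrightarrow> ereal r \<le> R \<Longrightarrow> ereal (norm x) < R"
  by (rule less_le_trans[of _ "ereal r"]) auto

lemma sqrt_type_diff:
  assumes r: "r > 0" and f: "sqrt_type r f a b" and g: "sqrt_type r g a' b'"
  shows "sqrt_type r (f - g) (a - a') (b - b')"
  unfolding sqrt_type_def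
proof (intro conjI)
  show "(\<lambda>n. fps_nth (f - g) n * r ^ n) sums (a - a')"
    using sums_diff[of "\<lambda>n. fps_nth f n * r ^ n" a "\<lambda>n. fps_nth g n * r ^ n" a'] f g
    by (simp add: sqrt_type_def algebra_simps)
  have "(\<lambda>n. fps_nth f n * r ^ n * wt n - fps_nth g n * r ^ n * wt n) \<longlonglongrightarrow> b / (2 * sqrt pi) - b' / (2 * sqrt pi)"
    using f g by (intro tendsto_diff) (auto simp: sqrt_type_def)
  then show "(\<lambda>n. fps_nth (f - g) n * r ^ n * wt n) \<longlonglongrightarrow> (b - b') / (2 * sqrt pi)"
    by (simp add: algebra_simps diff_divide_distrib)
  have "(\<lambda>x. (eval_fps f x - eval_fps g x) - ((a - a') - (b - b') * sqrt (1 - x / r)))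
       \<in> O[at_left r](\<lambda>x. (sqrt (1 - x / r))\<^sup>2)"
    using f g unfolding sqrt_type_def by (intro expansion_diff) auto
  also have "?this \<longleftrightarrow> (\<lambda>x. eval_fps (f - g) x - ((a - a') - (b - b') * sqrt (1 - x / r)))
       \<in> O[at_left r](\<lambda>x. (sqrt (1 - x / r))\<^sup>2)"
  proof (rule landau_o.big.in_cong)
    show "\<forall>\<^sub>F x in at_left r. (eval_fps f x - eval_fps g x) - ((a - a') - (b - b') * sqrt (1 - x / r)) =
         eval_fps (f - g) x - ((a - a') - (b - b') * sqrt (1 - x / r))"
      using eventually_at_left_pos[OF r]
    proof eventually_elim
      case (elim x)
      then have "ereal (norm x) < fps_conv_radius f" "ereal (norm x) < fps_conv_radius g"
        using sqrt_type_conv_radius[OF f r] sqrt_type_conv_radius[OF g r] 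
        by (blast intro: norm_less_conv_radius)+
      then show ?case by (simp add: eval_fps_diff)
    qed
  qed
  finally show "(\<lambda>x. eval_fps (f - g) x - ((a - a') - (b - b') * sqrt (1 - x / r)))
       \<in> O[at_left r](\<lambda>x. (sqrt (1 - x / r))\<^sup>2)" .
qed

lemma fps_mult_nth_scaled:
  "fps_nth (f * g) n * r ^ n = (\<Sum>j\<le>n. (fps_nth f j * r ^ j) * (fps_nth g (n - j) * r ^ (n - j)))"
  for f g :: "'a :: comm_semiring_1 fps"
proof -
  have "(\<Sum>j\<le>n. (fps_nth f j * r ^ j) * (fps_nth g (n - j) * r ^ (n - j))) =
     (\<Sum>j\<le>n. fps_nth f j * fps_nth g (n - j) * r ^ n)"
  proof (intro sum.cong refl)
    fix j assume "j \<in> {..n}"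
    then have "r ^ n = r ^ j * r ^ (n - j)" by (simp add: power_add [symmetric])
    then show "(fps_nth f j * r ^ j) * (fps_nth g (n - j) * r ^ (n - j)) = fps_nth f j * fps_nth g (n - j) * r ^ n"
      by (simp add: algebra_simps)
  qed
  then show ?thesis by (simp add: fps_mult_nth atLeast0AtMost sum_distrib_right)
qed

text \<open>The constant a b' + a' b arises twice from a product rule: as the linear term of the
  product of the expansions, and from \<open>convolution_wt\<close>, where weighting acts as a
  derivation.\<close>

lemma sqrt_type_mult:
  assumes r: "r > 0" and f: "sqrt_type r f a b" and g: "sqrt_type r g a' b'"
  shows "sqrt_type r (f * g) (a * a') (a * b' + a' * b)"
  unfolding sqrt_type_def
proof (intro conjI)
  define u v where "u = (\<lambda>n. fps_nth f n * r ^ n)" "v = (\<lambda>n. fps_nth g n * r ^ n)"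
  note u_v = this
  have su: "summable (\<lambda>n. \<bar>u n\<bar>)" "summable (\<lambda>n. \<bar>v n\<bar>)" "suminf u = a" "suminf v = a'"
    using sqrt_type_summable[OF f] sqrt_type_summable[OF g] sqrt_type_suminf[OF f] sqrt_type_suminf[OF g]
    by (simp_all add: u_v)
  have conv: "fps_nth (f * g) n * r ^ n = (\<Sum>j\<le>n. u j * v (n - j))" for n
    by (simp add: fps_mult_nth_scaled u_v)
  show "(\<lambda>n. fps_nth (f * g) n * r ^ n) sums (a * a')"
    unfolding conv su(3,4)[symmetric] using su by (intro Cauchy_product_sums) auto
  obtain C1 where C1: "\<And>n. \<bar>u n * wt n\<bar> \<le> C1" using sqrt_type_bound[OF f] unfolding u_v by blast
  obtain C2 where C2: "\<And>n. \<bar>v n * wt n\<bar> \<le> C2" using sqrt_type_bound[OF g] unfolding u_v by blast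
  have uv: "(\<lambda>n. u n * wt n) \<longlonglongrightarrow> b / (2 * sqrt pi)" "(\<lambda>n. v n * wt n) \<longlonglongrightarrow> b' / (2 * sqrt pi)"
    using f g by (simp_all add: sqrt_type_def u_v)
  have "(\<lambda>n. (\<Sum>j\<le>n. u j * v (n - j)) * wt n - 
     (\<Sum>j\<le>n. u j * (v (n - j) * wt (n - j))) - (\<Sum>j\<le>n. v j * (u (n - j) * wt (n - j)))) \<longlonglongrightarrow> 0"
    by (rule convolution_wt[of _ "max C1 C2"]) (use C1 C2 in \<open>auto simp: le_max_iff_disj\<close>)
  \<comment> \<open>Add back the two subtracted convolutions, whose limits are a b' and a' b divided
    by 2 sqrt pi.\<close>
  from tendsto_add[OF tendsto_add[OF this convolution_tendsto[OF su(1) uv(2)]] convolution_tendsto[OF su(2) uv(1)]]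
  show "(\<lambda>n. fps_nth (f * g) n * r ^ n * wt n) \<longlonglongrightarrow> (a * b' + a' * b) / (2 * sqrt pi)"
    unfolding conv su by (simp add: add_divide_distrib mult.commute)
  have "(\<lambda>x. eval_fps f x * eval_fps g x - (a * a' - (a * b' + a' * b) * sqrt (1 - x / r)))
       \<in> O[at_left r](\<lambda>x. (sqrt (1 - x / r))\<^sup>2)"
    using f g unfolding sqrt_type_def by (intro expansion_mult sqrt_bounded r) auto
  also have "?this \<longleftrightarrow> (\<lambda>x. eval_fps (f * g) x - (a * a' - (a * b' + a' * b) * sqrt (1 - x / r)))
       \<in> O[at_left r](\<lambda>x. (sqrt (1 - x / r))\<^sup>2)"
  proof (rule landau_o.big.in_cong)
    show "\<forall>\<^sub>F x in at_left r. eval_fps f x * eval_fps g x - (a * a' - (a * b' + a' * b) * sqrt (1 - x / r)) =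
         eval_fps (f * g) x - (a * a' - (a * b' + a' * b) * sqrt (1 - x / r))"
      using eventually_at_left_pos[OF r]
    proof eventually_elim
      case (elim x)
      then have "ereal (norm x) < fps_conv_radius f" "ereal (norm x) < fps_conv_radius g"
        using sqrt_type_conv_radius[OF f r] sqrt_type_conv_radius[OF g r] 
        by (blast intro: norm_less_conv_radius)+
      then show ?case by (simp add: eval_fps_mult)
    qed
  qed
  finally show "(\<lambda>x. eval_fps (f * g) x - (a * a' - (a * b' + a' * b) * sqrt (1 - x / r)))
       \<in> O[at_left r](\<lambda>x. (sqrt (1 - x / r))\<^sup>2)" .
qed

lemma eval_fps_nonneg_le:
  fixes f :: "real fps"
  assumes "\<And>n. 0 \<le> fps_nth f n" and f: "(\<lambda>n. fps_nth f n * r ^ n) sums a" and x: "0 \<le> x" "x \<le> r"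
  shows "0 \<le> eval_fps f x" "eval_fps f x \<le> a"
proof -
  have le: "fps_nth f n * x ^ n \<le> fps_nth f n * r ^ n" for n
    by (intro mult_left_mono power_mono assms)
  have nn: "0 \<le> fps_nth f n * x ^ n" for n
    using assms(1) x by auto
  have s: "summable (\<lambda>n. fps_nth f n * x ^ n)"
    by (rule summable_comparison_test'[of "\<lambda>n. fps_nth f n * r ^ n"])
       (use f le nn in \<open>auto simp: sums_iff abs_of_nonneg\<close>)
  show "0 \<le> eval_fps f x" unfolding eval_fps_def by (intro suminf_nonneg s nn)
  show "eval_fps f x \<le> a"
    using suminf_le[OF le s] f by (simp add: eval_fps_def sums_iff)
qed

text \<open>Nonnegativity makes p dominate f and p - f coefficientwise, so both are O(n^(-3/2))
  after scaling before any limit for f is known. The value a solves a (1 - p0 + a) = r, and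
  linearising there gives the constant p1 a / (1 - p0 + 2 a).\<close>

lemma sqrt_type_quadratic:
  assumes r: "r > 0" and p: "sqrt_type r p p0 p1" and p0: "p0 < 1"
    and f: "f = fps_X + f * (p - f)"
    and nonneg: "\<And>n. 0 \<le> fps_nth f n" "\<And>n. 0 \<le> fps_nth (p - f) n"
  obtains a where "a > 0" "sqrt_type r f a (p1 * a / (1 - p0 + 2 * a))"
proof -
  define u v \<pi> where "u = (\<lambda>n. fps_nth f n * r ^ n)" "v = (\<lambda>n. fps_nth (p - f) n * r ^ n)"
    "\<pi> = (\<lambda>n. fps_nth p n * r ^ n)"
  note defs = this
  have nn: "0 \<le> u n" "0 \<le> v n" and pi: "\<pi> n = u n + v n" for n
    using nonneg[of n] r by (auto simp: defs algebra_simps)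
  obtain C where "\<And>n. \<bar>\<pi> n * wt n\<bar> \<le> C" using sqrt_type_bound[OF p] unfolding defs by blast
  then have "\<pi> n * wt n \<le> C" for n by (meson abs_le_D1)
  moreover have "u n * wt n \<le> \<pi> n * wt n" "v n * wt n \<le> \<pi> n * wt n" for n
    using nn[of n] by (auto simp: pi intro!: mult_right_mono)
  moreover have "0 \<le> u n * wt n" "0 \<le> v n * wt n" for n
    using nn[of n] by simp_all
  ultimately have C: "\<bar>u n * wt n\<bar> \<le> C" "\<bar>v n * wt n\<bar> \<le> C" for n
    by (smt (verit))+
  have su: "summable (\<lambda>n. \<bar>u n\<bar>)" "summable (\<lambda>n. \<bar>v n\<bar>)"
    using C by (auto intro: summable_of_wt_bound)
  have su': "summable u" "summable v" using su by (auto intro: summable_rabs_cancel)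
  have p0_eq: "suminf \<pi> = p0" using sqrt_type_suminf[OF p] by (simp add: defs)
  define a where "a = suminf u"
  have v_sum: "suminf v = p0 - a"
    using suminf_add[OF su'] p0_eq unfolding pi [symmetric] by (simp add: a_def)
  have rec: "u n = (if n = 1 then r else 0) + (\<Sum>j\<le>n. u j * v (n - j))" for n
  proof -
    have "u n = fps_nth (fps_X + f * (p - f)) n * r ^ n"
      using arg_cong[OF f, of "\<lambda>t. fps_nth t n * r ^ n"] by (simp only: defs(1))
    also have "\<dots> = (if n = 1 then r else 0) + fps_nth (f * (p - f)) n * r ^ n"
      by (auto simp: distrib_right)
    finally show ?thesis by (simp only: fps_mult_nth_scaled defs)
  qed
  \<comment> \<open>Summing the recurrence over n evaluates the equation at x = r.\<close>
  have "(\<lambda>n. (if n = 1 then r else 0) + (\<Sum>j\<le>n. u j * v (n - j))) sums (r + suminf u * suminf v)"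
    using su by (intro sums_add Cauchy_product_sums sums_single[where f = "\<lambda>_. r"]) auto
  then have "u sums (r + a * (p0 - a))"
    unfolding rec [symmetric] a_def [symmetric] v_sum .
  then have "a = r + a * (p0 - a)"
    using sums_unique a_def by metis
  then have a_eq: "a * (1 - p0 + a) = r" by (simp add: algebra_simps)
  have "0 \<le> a" unfolding a_def by (intro suminf_nonneg su' nn)
  then have "a > 0" using a_eq r by (cases "a = 0") auto
  have coeffs: "(\<lambda>n. u n * wt n) \<longlonglongrightarrow> p1 * a / (1 - p0 + 2 * a) / (2 * sqrt pi)"
  proof -
    have lp: "(\<lambda>n. \<pi> n * wt n) \<longlonglongrightarrow> p1 / (2 * sqrt pi)"
      using p by (simp add: sqrt_type_def defs)
    have "(\<lambda>n. (\<Sum>j\<le>n. u j * v (n - j)) * wt n - 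
       (\<Sum>j\<le>n. u j * (v (n - j) * wt (n - j))) - (\<Sum>j\<le>n. v j * (u (n - j) * wt (n - j)))) \<longlonglongrightarrow> 0"
      by (rule convolution_wt[of _ C]) (rule C)+
    moreover have "(\<lambda>n. (if n = 1 then r else 0) * wt n) \<longlonglongrightarrow> 0"
    proof (rule tendsto_eventually)
      show "\<forall>\<^sub>F n in sequentially. (if n = 1 then r else 0) * wt n = 0"
        using eventually_gt_at_top[of 1] by eventually_elim auto
    qed
    \<comment> \<open>No limit is known for the weighted v. Writing v = \<pi> - u in the first
      convolution leaves \<pi>, which has one, and gathers the rest into a convolution of v - u with
      the weighted u.\<close>
    ultimately have "(\<lambda>n. ((\<Sum>j\<le>n. u j * v (n - j)) * wt n - 
       (\<Sum>j\<le>n. u j * (v (n - j) * wt (n - j))) - (\<Sum>j\<le>n. v j * (u (n - j) * wt (n - j))))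
       + (if n = 1 then r else 0) * wt n + (\<Sum>j\<le>n. u j * (\<pi> (n - j) * wt (n - j))))
       \<longlonglongrightarrow> 0 + 0 + p1 / (2 * sqrt pi) * suminf u"
      by (intro tendsto_add convolution_tendsto su lp)
    moreover have "((\<Sum>j\<le>n. u j * v (n - j)) * wt n - 
       (\<Sum>j\<le>n. u j * (v (n - j) * wt (n - j))) - (\<Sum>j\<le>n. v j * (u (n - j) * wt (n - j))))
       + (if n = 1 then r else 0) * wt n + (\<Sum>j\<le>n. u j * (\<pi> (n - j) * wt (n - j))) =
       u n * wt n - (\<Sum>j\<le>n. (v j - u j) * (u (n - j) * wt (n - j)))" for n
    proof -
      have "(\<Sum>j\<le>n. u j * (\<pi> (n - j) * wt (n - j))) = 
         (\<Sum>j\<le>n. u j * (u (n - j) * wt (n - j))) + (\<Sum>j\<le>n. u j * (v (n - j) * wt (n - j)))"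
        by (simp add: pi sum.distrib [symmetric] algebra_simps)
      moreover have "(\<Sum>j\<le>n. (v j - u j) * (u (n - j) * wt (n - j))) =
         (\<Sum>j\<le>n. v j * (u (n - j) * wt (n - j))) - (\<Sum>j\<le>n. u j * (u (n - j) * wt (n - j)))"
        by (simp add: left_diff_distrib sum_subtractf)
      moreover have "u n * wt n = (if n = 1 then r else 0) * wt n + (\<Sum>j\<le>n. u j * v (n - j)) * wt n"
        by (subst rec) (simp add: distrib_right)
      ultimately show ?thesis by simp
    qed
    ultimately have lim: "(\<lambda>n. u n * wt n - (\<Sum>j\<le>n. (v j - u j) * (u (n - j) * wt (n - j)))) \<longlonglongrightarrow> 
       p1 / (2 * sqrt pi) * a"
      by (simp add: a_def)
    have le: "\<bar>v n - u n\<bar> \<le> u n + v n" for n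
      using nn[of n] by linarith
    have sw: "summable (\<lambda>n. \<bar>v n - u n\<bar>)"
      by (rule summable_comparison_test'[OF summable_add[OF su']]) (use le in auto)
    \<comment> \<open>The contraction constant: |v - u| \<le> u + v termwise, and u + v sums to p0 <
      1.\<close>
    have "(\<Sum>n. \<bar>v n - u n\<bar>) \<le> (\<Sum>n. u n + v n)"
      by (intro suminf_le le sw summable_add su')
    also have "\<dots> < 1" using p0 p0_eq by (simp add: pi [symmetric])
    finally have "(\<lambda>n. u n * wt n) \<longlonglongrightarrow> p1 / (2 * sqrt pi) * a / (1 - (\<Sum>n. v n - u n))"
      by (intro contraction_tendsto[OF C(1) sw] lim)
    also have "(\<Sum>n. v n - u n) = p0 - 2 * a"
      using suminf_diff[OF su'(2,1)] by (simp add: v_sum a_def)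
    finally show ?thesis by (simp add: algebra_simps)
  qed
  have rad_f: "fps_conv_radius f \<ge> ereal r"
    using su'(1) r unfolding defs by (intro fps_conv_radius_ge)
  have rad_p: "fps_conv_radius p \<ge> ereal r" by (rule sqrt_type_conv_radius[OF p r])
  have "sqrt_type r f a (p1 * a / (1 - p0 + 2 * a))"
    unfolding sqrt_type_def
  proof (intro conjI)
    show sums: "(\<lambda>n. fps_nth f n * r ^ n) sums a"
      using su'(1) by (simp add: sums_iff a_def defs)
    show "(\<lambda>n. fps_nth f n * r ^ n * wt n) \<longlonglongrightarrow> p1 * a / (1 - p0 + 2 * a) / (2 * sqrt pi)"
      using coeffs by (simp add: defs)
    show "(\<lambda>x. eval_fps f x - (a - p1 * a / (1 - p0 + 2 * a) * sqrt (1 - x / r)))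
      \<in> O[at_left r](\<lambda>x. (sqrt (1 - x / r))\<^sup>2)"
    proof (rule expansion_quadratic[where p = "eval_fps p" and r = r])
      show "\<forall>\<^sub>F x in at_left r. 0 \<le> eval_fps f x \<and> eval_fps p x \<le> p0"
        using eventually_at_left_pos[OF r]
      proof eventually_elim
        case (elim x)
        have "0 \<le> fps_nth p n" for n using nonneg[of n] by simp
        moreover have "(\<lambda>n. fps_nth p n * r ^ n) sums p0" using p by (simp add: sqrt_type_def)
        ultimately show ?case
          using eval_fps_nonneg_le[OF nonneg(1) sums, of x] eval_fps_nonneg_le[of p r p0 x] elim by simp
      qed
      \<comment> \<open>The right-hand side is x in disguise, as s^2 = 1 - x/r.\<close>
      show "\<forall>\<^sub>F x in at_left r. eval_fps f x * (1 - eval_fps p x + eval_fps f x) = r * (1 - (sqrt (1 - x / r))\<^sup>2)"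
        using eventually_at_left_pos[OF r]
      proof eventually_elim
        case (elim x)
        have rad: "ereal (norm x) < fps_conv_radius f" "ereal (norm x) < fps_conv_radius p"
          using elim rad_f rad_p by (blast intro: norm_less_conv_radius)+
        have rad2: "ereal (norm x) < fps_conv_radius (p - f)" 
          using rad fps_conv_radius_diff[of p f] by (auto simp: min_def split: if_splits)
        have rad3: "ereal (norm x) < fps_conv_radius (f * (p - f))" 
          using rad rad2 fps_conv_radius_mult[of f "p - f"] by (auto simp: min_def split: if_splits)
        have "eval_fps f x = eval_fps (fps_X + f * (p - f)) x"
          using arg_cong[OF f, of "\<lambda>t. eval_fps t x"] .
        also have "\<dots> = x + eval_fps f x * (eval_fps p x - eval_fps f x)"
          using rad rad2 rad3 by (simp add: eval_fps_add eval_fps_mult eval_fps_diff)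
        finally show ?case using elim r by (simp add: field_simps)
      qed
    qed (use p a_eq \<open>0 \<le> a\<close> p0 sqrt_bounded[OF r] in \<open>auto simp: sqrt_type_def\<close>)
  qed
  with \<open>a > 0\<close> show ?thesis using that by blast
qed

section \<open>Square-root singularities of the generating functions\<close>

lemma Gamma_minus_half: "Gamma (-1/2 :: real) = - 2 * sqrt pi"
proof -
  have "(-1/2 :: real) \<notin> \<int>\<^sub>\<le>\<^sub>0"
    using fraction_not_in_Ints[of 2 "-1", where 'a = real] nonpos_Ints_subset_Ints by auto
  from Gamma_plus1[OF this] show ?thesis
    using Gamma_one_half_real by simp
qed

text \<open>These are the weighted coefficients of - sqrt (1 - x); the limit is - 1 / Gamma
  (-1/2).\<close>

lemma half_gbinomial_tendsto:
  "(\<lambda>n. - ((1/2 :: real) gchoose n) * (-1) ^ n * wt n) \<longlonglongrightarrow> 1 / (2 * sqrt pi)"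
proof -
  have "(\<lambda>n. ((1/2 :: real) gchoose n) / ((-1) ^ n / exp ((1/2 + 1) * of_real (ln (real n))))) 
      \<longlonglongrightarrow> inverse (Gamma (- (1/2)))"
    by (rule gbinomial_asymptotic)
  then have "(\<lambda>n. - (((1/2 :: real) gchoose n) / ((-1) ^ n / exp ((1/2 + 1) * of_real (ln (real n))))))
      \<longlonglongrightarrow> - inverse (Gamma (- (1/2)))"
    by (rule tendsto_minus)
  also have "- inverse (Gamma (- (1/2) :: real)) = 1 / (2 * sqrt pi)"
    using Gamma_minus_half by (simp add: field_simps)
  finally show ?thesis
  proof (rule Lim_transform_eventually)
    show "\<forall>\<^sub>F n in sequentially. 
       - (((1/2 :: real) gchoose n) / ((-1) ^ n / exp ((1/2 + 1) * of_real (ln (real n))))) =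
       - ((1/2 :: real) gchoose n) * (-1) ^ n * wt n"
      using eventually_gt_at_top[of 0]
    proof eventually_elim
      case (elim n)
      have "(-1 :: real) ^ n = 1 \<or> (-1 :: real) ^ n = -1" by (cases "even n") auto
      then show ?case using elim by (auto simp: wt_def powr_def)
    qed
  qed
qed

text \<open>Power series form a domain, and the constant terms exclude f = - g.\<close>

lemma fps_square_unique:
  fixes f g :: "real fps"
  assumes "f * f = g * g" "fps_nth f 0 = 1" "fps_nth g 0 = 1"
  shows "f = g"
proof -
  have "(f - g) * (f + g) = 0" using assms(1) by (simp add: algebra_simps)
  moreover have "fps_nth (f + g) 0 \<noteq> 0" using assms by simp
  then have "f + g \<noteq> 0" by fastforce
  ultimately show ?thesis by simp
qed

text \<open>Completing the square gives (1 - 2 T)^2 = 1 - 4 m x = 1 - x/r, so T = (1 - sqrt (1 -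
  x/r)) / 2 exactly. Scaling the coefficients by r^n removes m from them.\<close>

lemma sqrt_type_catalan:
  fixes T :: "real fps"
  assumes m: "m \<ge> 1" and r: "r = 1 / (4 * real m)"
    and T: "T = of_nat m * fps_X + T * T" and T0: "fps_nth T 0 = 0"
    and nonneg: "\<And>n. 0 \<le> fps_nth T n"
  shows "sqrt_type r T (1/2) (1/2)"
proof -
  have r0: "r > 0" and mr: "4 * real m * r = 1" using m r by auto
  \<comment> \<open>The binomial series of sqrt (1 - 4 m x).\<close>
  define B :: "real fps" where "B = fps_compose (fps_binomial (1/2)) (fps_const (- 4 * real m) * fps_X)"
  have "B * B = fps_compose (fps_binomial (1/2) * fps_binomial (1/2)) (fps_const (- 4 * real m) * fps_X)"
    unfolding B_def by (rule fps_compose_mult_distrib [symmetric]) simp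
  also have "fps_binomial (1/2) * fps_binomial (1/2) = (1 + fps_X :: real fps)"
    using fps_binomial_add_mult[of "1/2 :: real" "1/2"] fps_binomial_1[where 'a = real] by simp
  also have "fps_compose (1 + fps_X) (fps_const (- 4 * real m) * fps_X) = 1 + fps_const (- 4 * real m) * fps_X"
    by (simp add: fps_compose_add_distrib)
  also have "\<dots> = 1 - 4 * (of_nat m * fps_X)"
    by (simp add: fps_eq_iff fps_numeral_nth fps_of_nat [symmetric] numeral_fps_const)
  also have "of_nat m * fps_X = T - T * T" using T [symmetric] by (simp only: eq_diff_eq)
  also have "1 - 4 * (T - T * T) = (1 - 2 * T) * (1 - 2 * T)"
    by (simp add: algebra_simps)
  finally have BT: "B = 1 - 2 * T"
    by (rule fps_square_unique) (simp_all add: B_def T0 fps_numeral_nth)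
  define u where "u = (\<lambda>n. fps_nth T n * r ^ n)"
  have u_eq: "u n = - (1/2) * ((1/2) gchoose n) * (-1) ^ n" if "n > 0" for n
  proof -
    have "((1/2) gchoose n) * (- 4 * real m) ^ n = fps_nth B n"
      by (simp only: B_def fps_nth_compose_linear fps_binomial_nth) (rule mult.commute)
    also have "\<dots> = - 2 * fps_nth T n"
      using that by (simp add: BT numeral_fps_const)
    finally have "((1/2) gchoose n) * (- 4 * real m) ^ n = - 2 * fps_nth T n" .
    then have "fps_nth T n = - (1/2) * (((1/2) gchoose n) * (- 4 * real m) ^ n)"
      by simp
    then have "u n = - (1/2) * ((1/2) gchoose n) * ((- 4 * real m) ^ n * r ^ n)"
      by (simp add: u_def)
    also have "(- 4 * real m) ^ n * r ^ n = (-1) ^ n"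
      using mr by (simp add: power_mult_distrib [symmetric])
    finally show ?thesis .
  qed
  have lim: "(\<lambda>n. u n * wt n) \<longlonglongrightarrow> 1/2 / (2 * sqrt pi)"
  proof (rule Lim_transform_eventually)
    show "(\<lambda>n. 1/2 * (- ((1/2) gchoose n) * (-1) ^ n * wt n)) \<longlonglongrightarrow> 1/2 / (2 * sqrt pi)"
      using tendsto_mult_left[OF half_gbinomial_tendsto, of "1/2"] by simp
    show "\<forall>\<^sub>F n in sequentially. 1/2 * (- ((1/2) gchoose n) * (-1) ^ n * wt n) = u n * wt n"
      using eventually_gt_at_top[of 0] by eventually_elim (simp add: u_eq)
  qed
  then have "Bseq (\<lambda>n. u n * wt n)" by (intro convergent_imp_Bseq convergentI)
  then obtain C where "\<And>n. \<bar>u n * wt n\<bar> \<le> C" by (auto simp: Bseq_def)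
  then have su: "summable (\<lambda>n. \<bar>u n\<bar>)" by (rule summable_of_wt_bound)
  have su': "summable u" using su by (rule summable_rabs_cancel)
  define a where "a = suminf u"
  have rec: "u n = (if n = 1 then 1/4 else 0) + (\<Sum>j\<le>n. u j * u (n - j))" for n
  proof -
    have "u n = fps_nth (of_nat m * fps_X + T * T) n * r ^ n"
      using arg_cong[OF T, of "\<lambda>t. fps_nth t n * r ^ n"] by (simp only: u_def)
    also have "of_nat m * fps_X = fps_const (real m) * fps_X"
      by (simp only: fps_of_nat)
    also have "fps_nth (fps_const (real m) * fps_X + T * T) n * r ^ n =
        (if n = 1 then real m * r else 0) + fps_nth (T * T) n * r ^ n"
      by (auto simp: distrib_right)
    also have "real m * r = 1/4" using mr by simp
    finally show ?thesis by (simp only: fps_mult_nth_scaled u_def)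
  qed
  have "(\<lambda>n. (if n = 1 then 1/4 else 0) + (\<Sum>j\<le>n. u j * u (n - j))) sums (1/4 + suminf u * suminf u)"
    using su by (intro sums_add Cauchy_product_sums sums_single[where f = "\<lambda>_. 1/4"]) auto
  then have "u sums (1/4 + a * a)"
    unfolding rec [symmetric] a_def .
  then have "a = 1/4 + a * a"
    using sums_unique a_def by metis
  \<comment> \<open>At r the discriminant vanishes, so 1/2 is a double root.\<close>
  then have "(a - 1/2)\<^sup>2 = 0" by (simp add: power2_eq_square algebra_simps)
  then have a: "a = 1/2" by simp
  have sums: "(\<lambda>n. fps_nth T n * r ^ n) sums (1/2)"
    using su' a by (simp add: sums_iff a_def u_def)
  have rad: "fps_conv_radius T \<ge> ereal r"
    using sums r0 by (intro fps_conv_radius_ge) (auto simp: sums_iff)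
  have "eventually (\<lambda>x. eval_fps T x - (1/2 - 1/2 * sqrt (1 - x / r)) = 0) (at_left r)"
    using eventually_at_left_pos[OF r0]
  proof eventually_elim
    case (elim x)
    have rad': "ereal (norm x) < fps_conv_radius T"
      using elim rad by (blast intro: norm_less_conv_radius)
    have rad2: "ereal (norm x) < fps_conv_radius (T * T)" 
      using rad' fps_conv_radius_mult[of T T] by (auto simp: min_def split: if_splits)
    have rad3: "ereal (norm x) < fps_conv_radius (fps_const (real m) * fps_X)" 
      by (rule less_le_trans[OF _ fps_conv_radius_mult]) simp
    have "eval_fps T x = eval_fps (fps_const (real m) * fps_X + T * T) x"
      using arg_cong[OF T, of "\<lambda>t. eval_fps t x"] by (simp only: fps_of_nat)
    also have "\<dots> = real m * x + eval_fps T x * eval_fps T x"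
      using rad' rad2 rad3 by (simp add: eval_fps_add eval_fps_mult)
    finally have "(1 - 2 * eval_fps T x)\<^sup>2 = 1 - 4 * real m * x" 
      by (simp add: power2_eq_square algebra_simps)
    also have "\<dots> = 1 - x / r" by (simp add: r)
    \<comment> \<open>T is at most its value 1/2 at r, so 1 - 2 T is the nonnegative root.\<close>
    finally have "sqrt (1 - x / r) = 1 - 2 * eval_fps T x"
      using eval_fps_nonneg_le(2)[OF nonneg sums, of x] elim
      by (intro real_sqrt_unique) auto
    then show ?case by linarith
  qed
  then have "(\<lambda>x. eval_fps T x - (1/2 - 1/2 * sqrt (1 - x / r))) \<in> O[at_left r](\<lambda>x. (sqrt (1 - x / r))\<^sup>2)"
    by (intro bigoI[where c = 0]) (simp add: eventually_mono)
  then show ?thesis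
    using sums lim by (simp add: sqrt_type_def u_def)
qed

lemma g_count_0 [simp]: "g_count m k 0 = 0"
  by (simp add: g_count_eq valued_trees_at_def valued_trees_def)

lemma G_gf_nonneg [simp]: "0 \<le> fps_nth (G_gf m k :: real fps) n"
  by (simp add: G_gf_def)

lemma upper_gf_nth: "fps_nth (upper_gf m k :: 'a :: semiring_1 fps) n = of_nat (\<Sum>i\<in>{k..<m}. g_count m i n)"
  by (simp add: upper_gf_def fps_sum_nth G_gf_def)

lemma upper_gf_nonneg [simp]: "0 \<le> fps_nth (upper_gf m k :: real fps) n"
  by (simp only: upper_gf_nth of_nat_0_le_iff)

text \<open>Here \<open>upper_gf m k - G_gf m k\<close> is the next tail series. The constant b lies
  strictly between 0 and p1 because 0 < a < 1 - p0 + 2 a, so positivity survives the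
  subtraction.\<close>

lemma G_gf_sqrt_type_step:
  assumes k: "Suc k < m" and r: "r > 0"
    and p: "sqrt_type r (upper_gf m k) p0 p1" "p0 < 1" "0 < p1"
  obtains a b where "a > 0" "b > 0" "b < p1" "sqrt_type r (G_gf m k) a b"
    "sqrt_type r (upper_gf m (Suc k)) (p0 - a) (p1 - b)"
proof -
  have diff: "upper_gf m k - G_gf m k = (upper_gf m (Suc k) :: real fps)"
    using upper_gf_Suc[of k m, where 'a = real] k by simp
  obtain a where a: "a > 0" "sqrt_type r (G_gf m k) a (p1 * a / (1 - p0 + 2 * a))"
  proof (rule sqrt_type_quadratic[OF r p(1,2)])
    show "G_gf m k = fps_X + G_gf m k * (upper_gf m k - G_gf m k :: real fps)"
      unfolding diff by (rule G_gf_below_top[OF k])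
    show "0 \<le> fps_nth (upper_gf m k - G_gf m k :: real fps) n" for n
      unfolding diff by simp
  qed auto
  have "sqrt_type r (upper_gf m (Suc k)) (p0 - a) (p1 - p1 * a / (1 - p0 + 2 * a))"
    using sqrt_type_diff[OF r p(1) a(2)] unfolding diff .
  moreover have "0 < p1 * a / (1 - p0 + 2 * a)"
    using a p by (intro divide_pos_pos mult_pos_pos) auto
  moreover have "p1 * a < p1 * (1 - p0 + 2 * a)"
    using a p by (intro mult_strict_left_mono) auto
  then have "p1 * a / (1 - p0 + 2 * a) < p1"
    using a p by (simp add: divide_less_eq)
  ultimately show ?thesis using that a by blast
qed

text \<open>The value at r starts at 1/2 for k = 0, and each step subtracts a positive a. So p0
  stays below 1, as the quadratic step requires.\<close>

lemma upper_gf_sqrt_type: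
  assumes m: "m \<ge> 1" and r: "r = 1 / (4 * real m)"
  shows "k < m \<Longrightarrow> \<exists>p0 p1. sqrt_type r (upper_gf m k) p0 p1 \<and> p0 \<le> 1/2 \<and> 0 < p1"
proof (induction k)
  case 0
  have "sqrt_type r (upper_gf m 0) (1/2) (1/2)"
    by (rule sqrt_type_catalan[OF m r upper_gf_0 _ upper_gf_nonneg]) (simp add: upper_gf_nth)
  then show ?case by (intro exI[of _ "1/2"]) auto
next
  case (Suc k)
  have r0: "r > 0" using m r by simp
  obtain p0 p1 where p: "sqrt_type r (upper_gf m k) p0 p1" "p0 \<le> 1/2" "0 < p1"
    using Suc by auto
  then have "p0 < 1" by simp
  from G_gf_sqrt_type_step[OF Suc.prems r0 p(1) this p(3)] obtain a b where 
    ab: "a > 0" "b < p1" "sqrt_type r (upper_gf m (Suc k)) (p0 - a) (p1 - b)"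
    by metis
  then show ?case
    using p by (intro exI[of _ "p0 - a"] exI[of _ "p1 - b"]) auto
qed

lemma G_gf_sqrt_type:
  assumes m: "m \<ge> 1" and r: "r = 1 / (4 * real m)" and k: "k < m"
  shows "\<exists>a b. a > 0 \<and> b > 0 \<and> sqrt_type r (G_gf m k) a b"
proof -
  have r0: "r > 0" using m r by simp
  obtain p0 p1 where p: "sqrt_type r (upper_gf m k) p0 p1" "p0 \<le> 1/2" "0 < p1"
    using upper_gf_sqrt_type[OF m r k] by blast
  show ?thesis
  proof (cases "Suc k < m")
    case True
    have "p0 < 1" using p by simp
    from G_gf_sqrt_type_step[OF True r0 p(1) this p(3)] show ?thesis by metis
  next
    \<comment> \<open>At the top value the tail series is G_k itself. Only positivity of its value
      at r remains, and the single leaf supplies it.\<close>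
    case False
    then have "k = m - 1" using k by simp
    then have G: "sqrt_type r (G_gf m k) p0 p1"
      using p(1) upper_gf_last[of m, where 'a = real] m by simp
    have "g_count m k 1 \<ge> 1" using g_count_rec[OF k, of 1] by simp
    then have "0 < (\<Sum>n. fps_nth (G_gf m k) n * r ^ n)"
      using G r0 by (intro suminf_pos2[of _ 1]) (auto simp: sqrt_type_def sums_iff G_gf_def)
    then have "p0 > 0" using sqrt_type_suminf[OF G] by simp
    then show ?thesis using G p(3) by blast
  qed
qed

lemma sqrt_type_asymp_equiv:
  assumes r: "r > 0" and f: "sqrt_type r f a b" and b: "b \<noteq> 0"
  shows "fps_nth f \<sim>[at_top] (\<lambda>n. b / (2 * sqrt pi) * r powi (- int n) * real n powr (-3/2))"
proof (rule asymp_equivI')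
  define c where "c = b / (2 * sqrt pi)"
  have c: "c \<noteq> 0" using b by (simp add: c_def)
  have "(\<lambda>n. fps_nth f n * r ^ n * wt n / c) \<longlonglongrightarrow> c / c"
    using f c by (intro tendsto_intros) (auto simp: sqrt_type_def c_def)
  then have "(\<lambda>n. fps_nth f n * r ^ n * wt n / c) \<longlonglongrightarrow> 1" using c by simp
  then show "(\<lambda>n. fps_nth f n / (b / (2 * sqrt pi) * r powi (- int n) * real n powr (-3/2))) \<longlonglongrightarrow> 1"
  proof (rule Lim_transform_eventually)
    show "\<forall>\<^sub>F n in sequentially. fps_nth f n * r ^ n * wt n / c = 
        fps_nth f n / (b / (2 * sqrt pi) * r powi (- int n) * real n powr (-3/2))"
      using eventually_gt_at_top[of 0]
    proof eventually_elim
      case (elim n)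
      have "real n powr (-3/2) = 1 / wt n"
        by (simp add: wt_def powr_minus_divide)
      moreover have "r powi (- int n) = 1 / r ^ n"
        by (simp add: power_int_minus field_simps)
      ultimately show ?case unfolding c_def [symmetric] using r c elim by (simp add: wt_def)
    qed
  qed
qed

section \<open>Analytic continuation across the circle of convergence\<close>

text \<open>The local condition that \<open>dominant_singularities\<close> negates, isolated so that
  it can be propagated through algebraic operations.\<close>

definition continuable :: "complex fps \<Rightarrow> complex \<Rightarrow> bool" where
  "continuable f z \<longleftrightarrow> (\<exists>U h. open U \<and> z \<in> U \<and> h holomorphic_on U \<and>
     (\<forall>w \<in> U \<inter> ball 0 (norm z). h w = eval_fps f w))"

lemma continuable_diff:
  assumes "continuable f z" "continuable g z"
    and rad: "ereal (norm z) \<le> fps_conv_radius f" "ereal (norm z) \<le> fps_conv_radius g"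
  shows "continuable (f - g) z"
proof -
  obtain U h where U: "open U" "z \<in> U" "h holomorphic_on U" "\<And>w. w \<in> U \<inter> ball 0 (norm z) \<Longrightarrow> h w = eval_fps f w"
    using assms(1) unfolding continuable_def by blast
  obtain V k where V: "open V" "z \<in> V" "k holomorphic_on V" "\<And>w. w \<in> V \<inter> ball 0 (norm z) \<Longrightarrow> k w = eval_fps g w"
    using assms(2) unfolding continuable_def by blast
  have "(\<lambda>w. h w - k w) holomorphic_on U \<inter> V"
    using U V by (auto intro!: holomorphic_intros intro: holomorphic_on_subset)
  moreover have "h w - k w = eval_fps (f - g) w" if "w \<in> (U \<inter> V) \<inter> ball 0 (norm z)" for w
  proof -
    have "ereal (norm w) < ereal (norm z)" using that by simp
    then have "ereal (norm w) < fps_conv_radius f" "ereal (norm w) < fps_conv_radius g"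
      using rad by (meson less_le_trans)+
    then show ?thesis using that U(4) V(4) by (simp add: eval_fps_diff)
  qed
  ultimately show ?thesis
    unfolding continuable_def using U V
    by (intro exI[of _ "U \<inter> V"] exI[of _ "\<lambda>w. h w - k w"]) auto
qed

lemma continuable_mult:
  assumes "continuable f z" "continuable g z"
    and rad: "ereal (norm z) \<le> fps_conv_radius f" "ereal (norm z) \<le> fps_conv_radius g"
  shows "continuable (f * g) z"
proof -
  obtain U h where U: "open U" "z \<in> U" "h holomorphic_on U" "\<And>w. w \<in> U \<inter> ball 0 (norm z) \<Longrightarrow> h w = eval_fps f w"
    using assms(1) unfolding continuable_def by blast
  obtain V k where V: "open V" "z \<in> V" "k holomorphic_on V" "\<And>w. w \<in> V \<inter> ball 0 (norm z) \<Longrightarrow> k w = eval_fps g w"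
    using assms(2) unfolding continuable_def by blast
  have "(\<lambda>w. h w * k w) holomorphic_on U \<inter> V"
    using U V by (auto intro!: holomorphic_intros intro: holomorphic_on_subset)
  moreover have "h w * k w = eval_fps (f * g) w" if "w \<in> (U \<inter> V) \<inter> ball 0 (norm z)" for w
  proof -
    have "ereal (norm w) < ereal (norm z)" using that by simp
    then have "ereal (norm w) < fps_conv_radius f" "ereal (norm w) < fps_conv_radius g"
      using rad by (meson less_le_trans)+
    then show ?thesis using that U(4) V(4) by (simp add: eval_fps_mult)
  qed
  ultimately show ?thesis
    unfolding continuable_def using U V
    by (intro exI[of _ "U \<inter> V"] exI[of _ "\<lambda>w. h w * k w"]) auto
qed

text \<open>This covers polynomials, whose radius is infinite. By contraposition, a point without
  continuation is not interior to the disc of convergence.\<close>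

lemma continuable_inside:
  assumes "ereal (norm z) < fps_conv_radius f"
  shows "continuable f z"
  unfolding continuable_def
  using assms by (intro exI[of _ "eball 0 (fps_conv_radius f)"] exI[of _ "eval_fps f"])
    (auto intro!: holomorphic_on_eval_fps)

lemma continuable_const: "continuable (fps_const c) z" 
  by (rule continuable_inside) simp

lemma continuable_one: "continuable 1 z" 
  by (rule continuable_inside) simp

text \<open>The points t z approach z from inside the disc, where h is known to equal the series;
  this carries estimates on the series to the boundary point.\<close>

lemma radial_limit:
  assumes "open U" "z \<in> U" "h holomorphic_on U" "z \<noteq> 0"
  shows "((\<lambda>t. h (of_real t * z)) \<longlongrightarrow> h z) (at_left (1 :: real))"
    "eventually (\<lambda>t. of_real t * z \<in> U \<inter> ball 0 (norm z)) (at_left (1 :: real))"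
proof -
  have lim: "((\<lambda>t. of_real t * z) \<longlongrightarrow> of_real 1 * z) (at_left (1 :: real))"
    by (intro tendsto_intros)
  have "isCont h z"
    using holomorphic_on_imp_continuous_on[OF assms(3)] assms(1,2) continuous_on_eq_continuous_at by blast
  with lim show "((\<lambda>t. h (of_real t * z)) \<longlongrightarrow> h z) (at_left (1 :: real))"
    by (intro isCont_tendsto_compose[of z h]) auto
  have "eventually (\<lambda>t. of_real t * z \<in> U) (at_left (1 :: real))"
    using topological_tendstoD[OF lim assms(1)] assms(2) by simp
  moreover have "eventually (\<lambda>t. 0 < t \<and> t < 1) (at_left (1 :: real))"
    by (rule eventually_at_left_pos) simp
  ultimately show "eventually (\<lambda>t. of_real t * z \<in> U \<inter> ball 0 (norm z)) (at_left (1 :: real))"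
    by eventually_elim (use assms(4) in \<open>auto simp: norm_mult\<close>)
qed

text \<open>The local branch of \<open>\<surd>g\<close> at \<open>z\<close> agrees with \<open>f\<close> up to sign, and the sign is
  constant because the part of a small disc around \<open>z\<close> inside the disc of
  convergence is convex.\<close>

lemma continuable_sqrt:
  assumes g: "continuable g z" and fg: "f * f = g" and z: "z \<noteq> 0"
    and rad: "ereal (norm z) \<le> fps_conv_radius f"
    and c: "c > 0" "eventually (\<lambda>t. c \<le> norm (eval_fps g (of_real t * z))) (at_left (1 :: real))"
  shows "continuable f z"
proof -
  obtain U h where U: "open U" "z \<in> U" "h holomorphic_on U" "\<And>w. w \<in> U \<inter> ball 0 (norm z) \<Longrightarrow> h w = eval_fps g w"
    using g unfolding continuable_def by blast
  have f_sq: "h w = (eval_fps f w)\<^sup>2" if "w \<in> U \<inter> ball 0 (norm z)" for w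
  proof -
    have "ereal (norm w) < ereal (norm z)" using that by simp
    then have "ereal (norm w) < fps_conv_radius f" using rad by (rule less_le_trans)
    then have "eval_fps g w = (eval_fps f w)\<^sup>2"
      unfolding fg [symmetric] by (simp add: eval_fps_mult power2_eq_square)
    then show ?thesis using that U(4) by simp
  qed
  \<comment> \<open>The bound along the ray passes to the limit, so h does not vanish at z.\<close>
  have "c \<le> norm (h z)"
  proof (rule tendsto_lowerbound)
    show "((\<lambda>t. norm (h (of_real t * z))) \<longlongrightarrow> norm (h z)) (at_left (1 :: real))"
      by (intro tendsto_norm radial_limit[OF U(1-3) z])
    show "eventually (\<lambda>t. c \<le> norm (h (of_real t * z))) (at_left (1 :: real))"
      using c(2) radial_limit(2)[OF U(1-3) z] by eventually_elim (simp add: U(4))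
  qed simp
  then have hz: "h z \<noteq> 0" using c by auto
  have cont: "continuous_on U (\<lambda>w. Re (h w / h z))"
    using holomorphic_on_imp_continuous_on[OF U(3)] hz by (intro continuous_intros) auto
  \<comment> \<open>Near z the quotient h w / h z stays in the right half-plane, off the branch cut
    of \<open>csqrt\<close>.\<close>
  have "open (U \<inter> (\<lambda>w. Re (h w / h z)) -` {0<..})"
    by (rule continuous_open_preimage[OF cont U(1)]) simp
  moreover have "z \<in> U \<inter> (\<lambda>w. Re (h w / h z)) -` {0<..}"
    using U hz by simp
  ultimately obtain \<epsilon> where \<epsilon>: "\<epsilon> > 0" "ball z \<epsilon> \<subseteq> U \<inter> (\<lambda>w. Re (h w / h z)) -` {0<..}"
    using open_contains_ball by meson
  then have pos: "Re (h w / h z) > 0" "w \<in> U" if "w \<in> ball z \<epsilon>" for w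
    using that by auto
  define q where "q = (\<lambda>w. csqrt (h z) * csqrt (h w / h z))"
  have q_sq: "(q w)\<^sup>2 = h w" for w
    using hz by (simp add: q_def power_mult_distrib)
  have q_nz: "q w \<noteq> 0" if "w \<in> ball z \<epsilon>" for w
    using pos[OF that] q_sq[of w] by auto
  have q_hol: "q holomorphic_on ball z \<epsilon>"
    unfolding q_def
  proof (intro holomorphic_intros)
    show "h holomorphic_on ball z \<epsilon>"
      using U(3) pos(2) by (auto intro: holomorphic_on_subset)
    show "h w / h z \<notin> \<real>\<^sub>\<le>\<^sub>0" if "w \<in> ball z \<epsilon>" for w
      using pos(1)[OF that] by (auto simp: complex_nonpos_Reals_iff)
  qed (use hz in auto)
  let ?C = "ball z \<epsilon> \<inter> ball 0 (norm z)"
  have sgn: "eval_fps f w / q w \<in> {1, -1}" if "w \<in> ?C" for w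
  proof -
    have "(eval_fps f w)\<^sup>2 = (q w)\<^sup>2"
      using f_sq[of w] q_sq[of w] that pos(2)[of w] by simp
    then show ?thesis using q_nz[of w] that by (auto simp: power2_eq_iff)
  qed
  have "(\<lambda>w. eval_fps f w / q w) constant_on ?C"
  proof (rule continuous_finite_range_constant)
    show "connected ?C"
      by (intro convex_connected convex_Int convex_ball)
    have "?C \<subseteq> eball 0 (ereal (norm z))" by auto
    also have "\<dots> \<subseteq> eball 0 (fps_conv_radius f)" by (rule eball_mono[OF rad])
    finally have "?C \<subseteq> eball 0 (fps_conv_radius f)" .
    then have "continuous_on ?C (eval_fps f)"
      by (rule continuous_on_subset[OF continuous_on_eval_fps])
    moreover have "continuous_on ?C q"
      using holomorphic_on_imp_continuous_on[OF q_hol] by (rule continuous_on_subset) auto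
    ultimately show "continuous_on ?C (\<lambda>w. eval_fps f w / q w)"
      using q_nz by (intro continuous_on_divide) auto
    have "(\<lambda>w. eval_fps f w / q w) ` ?C \<subseteq> {1, -1}" using sgn by blast
    then show "finite ((\<lambda>w. eval_fps f w / q w) ` ?C)" by (rule finite_subset) simp
  qed
  then obtain \<kappa> where \<kappa>: "\<And>w. w \<in> ?C \<Longrightarrow> eval_fps f w / q w = \<kappa>"
    unfolding constant_on_def by blast
  show ?thesis
    unfolding continuable_def
  proof (intro exI[of _ "ball z \<epsilon>"] exI[of _ "\<lambda>w. \<kappa> * q w"] conjI ballI)
    show "(\<lambda>w. \<kappa> * q w) holomorphic_on ball z \<epsilon>"
      by (intro holomorphic_intros q_hol)
    fix w assume w: "w \<in> ?C"
    then show "\<kappa> * q w = eval_fps f w"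
      using \<kappa>[OF w] q_nz[of w] by (auto simp: field_simps)
  qed (use \<epsilon> in auto)
qed

section \<open>Complex power series with real coefficients\<close>

lemma G_gf_of_real: "fps_nth (G_gf m k :: complex fps) n = of_real (fps_nth (G_gf m k :: real fps) n)"
  by (simp add: G_gf_def)

lemma upper_gf_of_real: "fps_nth (upper_gf m k :: complex fps) n = of_real (fps_nth (upper_gf m k :: real fps) n)"
  by (simp add: upper_gf_nth)

lemma N_gf_of_real: "fps_nth (N_gf m i j :: complex fps) n = of_real (fps_nth (N_gf m i j :: real fps) n)"
  by (simp add: N_gf_def)

lemma fps_conv_radius_of_real:
  fixes F :: "complex fps" and f :: "real fps"
  assumes "\<And>n. fps_nth F n = of_real (fps_nth f n)"
  shows "fps_conv_radius F = fps_conv_radius f"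
proof -
  have "conv_radius (\<lambda>n. norm (fps_nth F n)) = conv_radius (\<lambda>n. norm (fps_nth f n))"
    using assms by simp
  then show ?thesis unfolding fps_conv_radius_def conv_radius_norm .
qed

lemma eval_fps_of_real:
  fixes F :: "complex fps" and f :: "real fps"
  assumes "\<And>n. fps_nth F n = of_real (fps_nth f n)" "ereal (norm x) < fps_conv_radius f"
  shows "eval_fps F (of_real x) = of_real (eval_fps f x)"
  using suminf_of_real[OF summable_fps[OF assms(2)], where 'a = complex]
  by (simp add: eval_fps_def assms(1))

lemma norm_eval_fps_le:
  fixes F :: "complex fps" and f :: "real fps"
  assumes F: "\<And>n. fps_nth F n = of_real (fps_nth f n)" and nonneg: "\<And>n. 0 \<le> fps_nth f n"
    and f: "(\<lambda>n. fps_nth f n * r ^ n) sums a" and w: "norm w \<le> r"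
  shows "norm (eval_fps F w) \<le> a"
proof -
  have le: "norm (fps_nth F n * w ^ n) \<le> fps_nth f n * r ^ n" for n
    using nonneg[of n] w by (auto simp: F norm_mult norm_power intro!: mult_left_mono power_mono)
  have "norm (eval_fps F w) \<le> (\<Sum>n. fps_nth f n * r ^ n)"
    unfolding eval_fps_def using f le by (intro norm_suminf_le) (auto simp: sums_iff)
  then show ?thesis using f by (simp add: sums_iff)
qed

text \<open>The series 1 - 2 S_0 is a square root of the polynomial 1 - z/r, which vanishes only at
  r.\<close>

lemma continuable_upper_gf_0:
  assumes m: "m \<ge> 1" and r: "r = 1 / (4 * real m)" and z: "norm z = r" "z \<noteq> of_real r"
  shows "continuable (upper_gf m 0) z"
proof -
  let ?T = "upper_gf m 0 :: complex fps"
  define g :: "complex fps" where "g = 1 - fps_const (4 * of_nat m) * fps_X"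
  have r0: "r > 0" using m r by simp
  have sq: "(1 - fps_const 2 * ?T) * (1 - fps_const 2 * ?T) = g"
  proof -
    have "of_nat m * fps_X = ?T - ?T * ?T"
      using upper_gf_0[of m, where 'a = complex, symmetric] by (simp only: eq_diff_eq)
    moreover have "g = 1 - 4 * (of_nat m * fps_X)"
      unfolding g_def numeral_fps_const fps_of_nat [symmetric] by (simp add: mult.assoc [symmetric])
    ultimately have "g = 1 - 4 * (?T - ?T * ?T)" by simp
    also have "\<dots> = (1 - 2 * ?T) * (1 - 2 * ?T)" by (simp add: algebra_simps)
    finally show ?thesis by (simp only: numeral_fps_const)
  qed
  obtain p0 p1 where "sqrt_type r (upper_gf m 0) p0 p1"
    using upper_gf_sqrt_type[OF m r, of 0] m by auto
  then have rad: "ereal (norm z) \<le> fps_conv_radius ?T"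
    using sqrt_type_conv_radius[OF _ r0] fps_conv_radius_of_real[of ?T, OF upper_gf_of_real] z by simp
  have rad2: "ereal (norm z) \<le> fps_conv_radius (1 - fps_const 2 * ?T)"
    using rad fps_conv_radius_diff[of 1 "fps_const 2 * ?T"] by (simp add: fps_conv_radius_cmult_left)
  have rad_lin: "fps_conv_radius (fps_const (4 * of_nat m :: complex) * fps_X) = \<infinity>"
    using m by (subst fps_conv_radius_cmult_left) auto
  have rad_g: "fps_conv_radius g = \<infinity>"
    using fps_conv_radius_diff[of 1 "fps_const (4 * of_nat m :: complex) * fps_X"] 
    by (simp add: g_def rad_lin)
  have eval_g: "eval_fps g w = 1 - w / of_real r" for w
    using m unfolding g_def by (subst eval_fps_diff) (auto simp: rad_lin eval_fps_mult r)
  \<comment> \<open>Half the limit of the norm of g along the ray, hence a lower bound near its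
    end.\<close>
  define c where "c = norm (1 - z / of_real r) / 2"
  have "z / of_real r \<noteq> 1" using z r0 by simp
  then have c: "c > 0" by (simp add: c_def)
  have "((\<lambda>t. norm (eval_fps g (of_real t * z))) \<longlongrightarrow> norm (1 - of_real 1 * z / of_real r)) (at_left (1 :: real))"
    unfolding eval_g using r0 by (intro tendsto_intros) auto
  then have "eventually (\<lambda>t. c < norm (eval_fps g (of_real t * z))) (at_left (1 :: real))"
    by (rule order_tendstoD(1)) (use c in \<open>simp add: c_def\<close>)
  then have "eventually (\<lambda>t. c \<le> norm (eval_fps g (of_real t * z))) (at_left (1 :: real))"
    by eventually_elim simp
  moreover have "continuable g z" by (rule continuable_inside) (simp add: rad_g)
  moreover have "z \<noteq> 0" using z r0 by auto
  ultimately have "continuable (1 - fps_const 2 * ?T) z"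
    using continuable_sqrt[OF _ sq _ rad2 c] by blast
  then have "continuable (1 - (1 - fps_const 2 * ?T)) z"
    by (intro continuable_diff[OF continuable_one _ _ rad2]) auto
  then have "continuable (fps_const (1/2) * (1 - (1 - fps_const 2 * ?T))) z"
    using rad2 fps_conv_radius_diff[of 1 "1 - fps_const 2 * ?T"]
    by (intro continuable_mult[OF continuable_const]) (auto simp: min_def split: if_splits)
  also have "fps_const (1/2) * (1 - (1 - fps_const 2 * ?T)) = ?T"
    by (simp add: mult.assoc [symmetric])
  finally show ?thesis .
qed

text \<open>With D = 1 - S_(k+1) + G_k, the discriminant D^2 is continuable because S_k is. Hence D
  is continuable, and so is 2 G_k = D - (1 - S_k).\<close>

lemma continuable_G_gf_step:
  assumes r: "r > 0" and k: "Suc k < m" and z: "norm z = r"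
    and p: "sqrt_type r (upper_gf m k) p0 p1" "p0 < 1" "0 < p1"
    and cont: "continuable (upper_gf m k) z"
  shows "continuable (G_gf m k) z"
proof -
  let ?P = "upper_gf m k :: complex fps" and ?G = "G_gf m k :: complex fps" 
  let ?S = "upper_gf m (Suc k) :: complex fps"
  have PGS: "?P = ?G + ?S" using upper_gf_Suc[of k m] k by simp
  have X: "fps_X = ?G - ?G * ?S"
    using G_gf_below_top[OF k, where 'a = complex, symmetric] by (simp only: eq_diff_eq)
  obtain a b where "sqrt_type r (G_gf m k) a b" "sqrt_type r (upper_gf m (Suc k)) (p0 - a) (p1 - b)"
    by (rule G_gf_sqrt_type_step[OF k r p])
  note ab = this
  have rad_P: "ereal (norm z) \<le> fps_conv_radius ?P"
    using sqrt_type_conv_radius[OF p(1) r] fps_conv_radius_of_real[of ?P, OF upper_gf_of_real] z by simp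
  have rad_G: "ereal (norm z) \<le> fps_conv_radius ?G"
    using sqrt_type_conv_radius[OF ab(1) r] fps_conv_radius_of_real[of ?G, OF G_gf_of_real] z by simp
  have rad_S: "ereal (norm z) \<le> fps_conv_radius ?S"
    using sqrt_type_conv_radius[OF ab(2) r] fps_conv_radius_of_real[of ?S, OF upper_gf_of_real] z by simp
  define D where "D = 1 - (?S - ?G)"
  \<comment> \<open>The summand 4 x is written as a subtraction so that
    \<open>continuable_diff\<close> applies.\<close>
  define g where "g = (1 - ?P) * (1 - ?P) - fps_const (-4) * fps_X"
  have DD: "D * D = g"
    unfolding D_def g_def PGS X 
    by (simp add: algebra_simps numeral_fps_const flip: fps_const_neg)
  have rad_SG: "ereal (norm z) \<le> fps_conv_radius (?S - ?G)"
    using rad_G rad_S fps_conv_radius_diff[of ?S ?G] by (auto simp: min_def split: if_splits)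
  have rad_D: "ereal (norm z) \<le> fps_conv_radius D"
    unfolding D_def using rad_SG fps_conv_radius_diff[of 1 "?S - ?G"] by (auto simp: min_def split: if_splits)
  have rad_1P: "ereal (norm z) \<le> fps_conv_radius (1 - ?P)"
    using rad_P fps_conv_radius_diff[of 1 ?P] by (auto simp: min_def split: if_splits)
  have rad_PP: "ereal (norm z) \<le> fps_conv_radius ((1 - ?P) * (1 - ?P))"
    using rad_1P fps_conv_radius_mult[of "1 - ?P" "1 - ?P"] by (auto simp: min_def split: if_splits)
  have rad_4: "fps_conv_radius (fps_const (-4 :: complex) * fps_X) = \<infinity>"
    by (subst fps_conv_radius_cmult_left) auto
  have cont_1P: "continuable (1 - ?P) z"
    by (intro continuable_diff[OF continuable_one cont] rad_P) auto
  have "continuable (fps_const (-4) * fps_X) z"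
    by (rule continuable_inside) (simp only: rad_4, simp)
  then have cont_g: "continuable g z"
    unfolding g_def using rad_4
    by (intro continuable_diff[OF continuable_mult[OF cont_1P cont_1P rad_1P rad_1P]] rad_PP) auto
  have low: "(1 - p0)\<^sup>2 \<le> norm (eval_fps g w)" if w: "norm w < r" for w
  proof -
    have "ereal (norm w) < ereal (norm z)" using w z by simp
    note rads = less_le_trans[OF this rad_G] less_le_trans[OF this rad_S] less_le_trans[OF this rad_SG]
       less_le_trans[OF this rad_D]
    have "eval_fps D w = 1 - (eval_fps ?S w - eval_fps ?G w)"
      unfolding D_def using rads by (simp add: eval_fps_diff)
    \<comment> \<open>Nonnegative coefficients bound both sums on the disc by their values at r,
      which add up to p0.\<close>
    moreover have "norm (eval_fps ?G w) \<le> a" "norm (eval_fps ?S w) \<le> p0 - a"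
      using ab w by (auto intro!: norm_eval_fps_le[where r = r] G_gf_of_real upper_gf_of_real simp: sqrt_type_def)
    moreover have "norm (1 :: complex) \<le> norm (1 - (eval_fps ?S w - eval_fps ?G w)) + norm (eval_fps ?S w - eval_fps ?G w)"
      using norm_triangle_ineq[of "1 - (eval_fps ?S w - eval_fps ?G w)" "eval_fps ?S w - eval_fps ?G w"] by simp
    moreover have "norm (eval_fps ?S w - eval_fps ?G w) \<le> norm (eval_fps ?S w) + norm (eval_fps ?G w)"
      by (rule norm_triangle_ineq4)
    ultimately have "1 - p0 \<le> norm (eval_fps D w)" by simp
    then have "(1 - p0)\<^sup>2 \<le> (norm (eval_fps D w))\<^sup>2"
      using p(2) by (intro power_mono) auto
    also have "\<dots> = norm (eval_fps g w)"
      using rads by (simp add: DD [symmetric] eval_fps_mult norm_mult power2_eq_square)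
    finally show ?thesis .
  qed
  have "continuable D z"
  proof (rule continuable_sqrt[OF cont_g DD _ rad_D])
    show "z \<noteq> 0" "(1 - p0)\<^sup>2 > 0" using z r p by auto
    have "eventually (\<lambda>t. 0 < t \<and> t < 1) (at_left (1 :: real))"
      by (rule eventually_at_left_pos) simp
    then show "eventually (\<lambda>t. (1 - p0)\<^sup>2 \<le> norm (eval_fps g (of_real t * z))) (at_left (1 :: real))"
      by eventually_elim (use z r in \<open>auto intro!: low simp: norm_mult\<close>)
  qed
  then have "continuable (D - (1 - ?P)) z"
    by (rule continuable_diff[OF _ cont_1P rad_D rad_1P])
  then have "continuable (fps_const (1/2) * (D - (1 - ?P))) z"
    using rad_D rad_1P fps_conv_radius_diff[of D "1 - ?P"]
    by (intro continuable_mult[OF continuable_const]) (auto simp: min_def split: if_splits)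
  also have "D - (1 - ?P) = fps_const 2 * ?G"
    by (simp add: D_def PGS flip: numeral_fps_const)
  also have "fps_const (1/2) * (fps_const 2 * ?G) = ?G"
    by (simp add: mult.assoc [symmetric])
  finally show ?thesis .
qed

lemma continuable_upper_gf:
  assumes m: "m \<ge> 1" and r: "r = 1 / (4 * real m)" and z: "norm z = r" "z \<noteq> of_real r"
  shows "k < m \<Longrightarrow> continuable (upper_gf m k) z"
proof (induction k)
  case 0
  show ?case by (rule continuable_upper_gf_0[OF m r z])
next
  case (Suc k)
  have r0: "r > 0" using m r by simp
  obtain p0 p1 where p: "sqrt_type r (upper_gf m k) p0 p1" "p0 \<le> 1/2" "0 < p1"
    using upper_gf_sqrt_type[OF m r, of k] Suc.prems by auto
  have P: "continuable (upper_gf m k) z" using Suc by simp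
  have G: "continuable (G_gf m k) z"
    using continuable_G_gf_step[OF r0 Suc.prems z(1) p(1) _ p(3) P] p(2) by simp
  obtain a b where ab: "sqrt_type r (G_gf m k) a b"
    using G_gf_sqrt_type[OF m r, of k] Suc.prems by auto
  have "continuable (upper_gf m k - G_gf m k) z"
    using sqrt_type_conv_radius[OF p(1) r0] sqrt_type_conv_radius[OF ab r0] z
      fps_conv_radius_of_real[OF upper_gf_of_real, of m k] fps_conv_radius_of_real[OF G_gf_of_real, of m k]
    by (intro continuable_diff P G) auto
  also have "upper_gf m k - G_gf m k = (upper_gf m (Suc k) :: complex fps)"
    using upper_gf_Suc[of k m, where 'a = complex] Suc.prems by simp
  finally show ?case .
qed

lemma continuable_G_gf:
  assumes m: "m \<ge> 1" and r: "r = 1 / (4 * real m)" and z: "norm z = r" "z \<noteq> of_real r" and k: "k < m"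
  shows "continuable (G_gf m k) z"
proof (cases "Suc k < m")
  case True
  have r0: "r > 0" using m r by simp
  obtain p0 p1 where p: "sqrt_type r (upper_gf m k) p0 p1" "p0 \<le> 1/2" "0 < p1"
    using upper_gf_sqrt_type[OF m r k] by blast
  then have "p0 < 1" by simp
  show ?thesis
    by (rule continuable_G_gf_step[OF r0 True z(1) p(1) \<open>p0 < 1\<close> p(3) continuable_upper_gf[OF m r z k]])
next
  case False
  then have "k = m - 1" using k by simp
  then show ?thesis
    using continuable_upper_gf[OF m r z k] upper_gf_last[of m, where 'a = complex] m by simp
qed

text \<open>A holomorphic continuation would be Lipschitz at \<open>r\<close>, whereas \<open>\<surd>(1 - x/r)\<close> is not.\<close>

lemma sqrt_type_not_continuable:
  fixes F :: "complex fps"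
  assumes r: "r > 0" and f: "sqrt_type r f a b" and b: "b \<noteq> 0"
    and F: "\<And>n. fps_nth F n = of_real (fps_nth f n)"
  shows "\<not> continuable F (of_real r)"
proof
  assume "continuable F (of_real r)"
  then obtain U h where U: "open U" "of_real r \<in> U" "h holomorphic_on U" 
      "\<And>w. w \<in> U \<inter> ball 0 r \<Longrightarrow> h w = eval_fps F w"
    unfolding continuable_def using r by auto
  obtain d where d: "(h has_field_derivative d) (at (of_real r))"
    using U holomorphic_on_imp_differentiable_at field_differentiable_def by blast
  define s where "s = (\<lambda>x. sqrt (1 - x / r))"
  have lim: "(of_real \<longlongrightarrow> (of_real r :: complex)) (at_left r)"
    by (intro tendsto_intros)
  have fl: "filterlim (of_real :: real \<Rightarrow> complex) (at (of_real r)) (at_left r)"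
    unfolding filterlim_at using lim eventually_at_left_pos[OF r] by (auto elim: eventually_mono)
  have "((\<lambda>w. (h w - h (of_real r)) / (w - of_real r)) \<longlongrightarrow> d) (at (of_real r))"
    using d by (simp add: has_field_derivative_iff)
  from filterlim_compose[OF this fl]
  have "((\<lambda>x. (h (of_real x) - h (of_real r)) / (of_real x - of_real r)) \<longlongrightarrow> d) (at_left r)" .
  moreover have s0: "(s \<longlongrightarrow> 0) (at_left r)"
  proof -
    have "(s \<longlongrightarrow> sqrt (1 - r / r)) (at_left r)"
      unfolding s_def using r by (intro tendsto_intros) auto
    then show ?thesis using r by simp
  qed
  \<comment> \<open>As x - r = - r s^2, the factor - r s turns the difference quotient into (h x - h
    r) / s, so differentiability at r forces that quotient to 0.\<close>
  ultimately have "((\<lambda>x. (h (of_real x) - h (of_real r)) / (of_real x - of_real r) * of_real (- r * s x)) \<longlongrightarrow> 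
     d * of_real (- r * 0)) (at_left r)"
    by (intro tendsto_intros)
  then have 1: "((\<lambda>x. (h (of_real x) - h (of_real r)) / (of_real x - of_real r) * of_real (- r * s x)) \<longlongrightarrow> 0) (at_left r)"
    by simp
  have "eventually (\<lambda>x. of_real x \<in> U) (at_left r)"
    using topological_tendstoD[OF lim U(1,2)] .
  then have heq: "eventually (\<lambda>x. h (of_real x) = of_real (eval_fps f x)) (at_left r)"
    using eventually_at_left_pos[OF r]
  proof eventually_elim
    case (elim x)
    have "ereal (norm x) < fps_conv_radius f"
      using elim sqrt_type_conv_radius[OF f r] by (blast intro: norm_less_conv_radius)
    then show ?case using elim U(4)[of "of_real x"] by (simp add: eval_fps_of_real[OF F])
  qed
  obtain K where K: "eventually (\<lambda>x. \<bar>eval_fps f x - (a - b * s x)\<bar> \<le> K * (s x)\<^sup>2) (at_left r)"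
    using f by (auto simp: sqrt_type_def s_def elim!: landau_o.bigE)
  have s_pos: "eventually (\<lambda>x. s x > 0 \<and> (s x)\<^sup>2 = (r - x) / r) (at_left r)"
    using eventually_at_left_pos[OF r] by eventually_elim (use r in \<open>auto simp: s_def diff_divide_distrib\<close>)
  \<comment> \<open>The expansion gives the corresponding quotient of the series the limit -
    b.\<close>
  have fa: "((\<lambda>x. (eval_fps f x - a) / s x) \<longlongrightarrow> - b) (at_left r)"
  proof -
    have "((\<lambda>x. (eval_fps f x - a) / s x - (- b)) \<longlongrightarrow> 0) (at_left r)"
    proof (rule Lim_null_comparison)
      show "eventually (\<lambda>x. norm ((eval_fps f x - a) / s x - (- b)) \<le> K * s x) (at_left r)"
        using K s_pos
      proof eventually_elim
        case (elim x)
        have "(eval_fps f x - a) / s x - (- b) = (eval_fps f x - (a - b * s x)) / s x"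
          using elim by (simp add: field_simps)
        then have "norm ((eval_fps f x - a) / s x - (- b)) = \<bar>eval_fps f x - (a - b * s x)\<bar> / s x"
          using elim by (simp add: abs_divide)
        also have "\<dots> \<le> K * (s x)\<^sup>2 / s x"
          using elim by (intro divide_right_mono) auto
        finally show ?case using elim by (simp add: power2_eq_square)
      qed
      show "((\<lambda>x. K * s x) \<longlongrightarrow> 0) (at_left r)"
        by (rule tendsto_mult_right_zero[OF s0])
    qed
    then show ?thesis using LIM_zero_iff by blast
  qed
  have "((\<lambda>x. (eval_fps f x - a) / s x * s x + a) \<longlongrightarrow> - b * 0 + a) (at_left r)"
    by (intro tendsto_intros fa s0)
  then have "((\<lambda>x. (eval_fps f x - a) / s x * s x + a) \<longlongrightarrow> a) (at_left r)" by simp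
  then have "((\<lambda>x. h (of_real x)) \<longlongrightarrow> of_real a) (at_left r)"
  proof (rule Lim_transform_eventually[OF tendsto_of_real])
    show "eventually (\<lambda>x. of_real ((eval_fps f x - a) / s x * s x + a) = h (of_real x)) (at_left r)"
      using heq s_pos by eventually_elim simp
  qed
  moreover have "isCont h (of_real r)" using d by (rule DERIV_isCont)
  then have "((\<lambda>x. h (of_real x)) \<longlongrightarrow> h (of_real r)) (at_left r)"
    by (rule isCont_tendsto_compose) (rule lim)
  ultimately have hr: "h (of_real r) = of_real a"
    by (intro tendsto_unique[OF _ _ \<open>((\<lambda>x. h (of_real x)) \<longlongrightarrow> of_real a) (at_left r)\<close>]) auto
  have "eventually (\<lambda>x. (h (of_real x) - h (of_real r)) / (of_real x - of_real r) * of_real (- r * s x)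
     = of_real ((eval_fps f x - a) / s x)) (at_left r)"
    using heq s_pos eventually_at_left_pos[OF r]
  proof eventually_elim
    case (elim x)
    have "r * (s x)\<^sup>2 = r - x" using elim r by simp
    then have "- r * s x / (x - r) = 1 / s x"
      using elim by (simp add: field_simps power2_eq_square)
    then have "(eval_fps f x - a) / (x - r) * (- r * s x) = (eval_fps f x - a) / s x"
      by (metis times_divide_eq_left times_divide_eq_right mult.right_neutral)
    from arg_cong[OF this, of "of_real :: real \<Rightarrow> complex"] show ?case
      using elim hr by simp
  qed
  from Lim_transform_eventually[OF 1 this]
  have "((\<lambda>x. of_real ((eval_fps f x - a) / s x) :: complex) \<longlongrightarrow> of_real 0) (at_left r)" by simp
  then have "((\<lambda>x. (eval_fps f x - a) / s x) \<longlongrightarrow> 0) (at_left r)"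
    unfolding tendsto_of_real_iff .
  from tendsto_unique[OF _ this fa] have "b = 0" by simp
  with b show False ..
qed

text \<open>A larger radius would make r an interior point, where the complex copy \<open>F\<close>
  is continuable, against \<open>sqrt_type_not_continuable\<close>.\<close>

lemma sqrt_type_conv_radius_eq:
  assumes r: "r > 0" and f: "sqrt_type r f a b" and b: "b \<noteq> 0"
  shows "fps_conv_radius f = ereal r"
proof -
  define F :: "complex fps" where "F = Abs_fps (\<lambda>n. of_real (fps_nth f n))"
  have F: "fps_nth F n = of_real (fps_nth f n)" for n by (simp add: F_def)
  have "\<not> ereal (norm (of_real r :: complex)) < fps_conv_radius F"
    using sqrt_type_not_continuable[OF r f b F] continuable_inside by blast
  then show ?thesis
    using sqrt_type_conv_radius[OF f r] r fps_conv_radius_of_real[OF F] by simp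
qed

theorem theorem10:
  fixes m :: nat and r :: real
  assumes "m \<ge> 2" and "r = 1 / (4 * real m)"
  shows "\<exists>a b :: nat \<Rightarrow> real.
    (\<forall>k<m.
      b k \<noteq> 0 \<and>
      (\<lambda>x. eval_fps (G_gf m k) x - (a k - b k * sqrt (1 - x / r)))
        \<in> O[at_left r](\<lambda>x. 1 - x / r) \<and>
      fps_nth (G_gf m k) \<sim>[at_top]
        (\<lambda>n. b k / (2 * sqrt pi) * r powi (- int n) * real n powr (-3/2)) \<and>
      fps_nth (G_gf m k) \<sim>[at_top]
        (\<lambda>n. b k / (2 * sqrt pi) * (4 * real m) ^ n * real n powr (-3/2))) \<and>
    (\<forall>i<m. \<forall>j<m. \<exists>A B :: real.
      B = a i * b j + a j * b i \<and>
      (\<lambda>x. eval_fps (N_gf m i j) x - (A - B * sqrt (1 - x / r)))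
        \<in> O[at_left r](\<lambda>x. 1 - x / r) \<and>
      (\<lambda>n. real (N_count m i j n)) \<sim>[at_top]
        (\<lambda>n. B / (2 * sqrt pi) * r powi (- int n) * real n powr (-3/2)) \<and>
      (\<lambda>n. real (N_count m i j n)) \<sim>[at_top]
        (\<lambda>n. B / (2 * sqrt pi) * (4 * real m) ^ n * real n powr (-3/2)) \<and>
      dominant_singularities (N_gf m i j) = {complex_of_real r} \<and>
      (\<lambda>n. real (N_count m i j n)) \<in> \<Theta>(\<lambda>n. (4 * real m) ^ n * real n powr (-3/2)))"
proof -
  have m: "m \<ge> 1" and r: "r > 0" using assms by auto
  have powi: "r powi (- int n) = (4 * real m) ^ n" for n
    using m by (simp add: assms(2) power_int_minus power_divide)
  have expansion: "(\<lambda>x. eval_fps f x - (a - b * sqrt (1 - x / r))) \<in> O[at_left r](\<lambda>x. 1 - x / r)"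
    if "sqrt_type r f a b" for f a b
  proof -
    have "(\<lambda>x. eval_fps f x - (a - b * sqrt (1 - x / r))) \<in> O[at_left r](\<lambda>x. (sqrt (1 - x / r))\<^sup>2)"
      using that by (simp add: sqrt_type_def)
    \<comment> \<open>The identity uses x < r, where 1 - x/r is nonnegative.\<close>
    also have "eventually (\<lambda>x. (sqrt (1 - x / r))\<^sup>2 = 1 - x / r) (at_left r)"
      using eventually_at_left_pos[OF r] by eventually_elim simp
    then have "O[at_left r](\<lambda>x. (sqrt (1 - x / r))\<^sup>2) = O[at_left r](\<lambda>x. 1 - x / r)"
      by (rule landau_o.big.cong)
    finally show ?thesis .
  qed
  have "\<forall>k. \<exists>a b. k < m \<longrightarrow> a > 0 \<and> b > 0 \<and> sqrt_type r (G_gf m k) a b"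
    using G_gf_sqrt_type[OF m assms(2)] by blast
  then obtain a b where ab: "\<And>k. k < m \<Longrightarrow> a k > 0 \<and> b k > 0 \<and> sqrt_type r (G_gf m k) (a k) (b k)"
    by metis
  show ?thesis
  proof (rule exI[of _ a], rule exI[of _ b], intro conjI allI impI)
    fix k assume k: "k < m"
    have G: "sqrt_type r (G_gf m k) (a k) (b k)" and bk: "b k \<noteq> 0" using ab[OF k] by auto
    show "b k \<noteq> 0" by (rule bk)
    show "(\<lambda>x. eval_fps (G_gf m k) x - (a k - b k * sqrt (1 - x / r))) \<in> O[at_left r](\<lambda>x. 1 - x / r)"
      by (rule expansion[OF G])
    show asymp: "fps_nth (G_gf m k) \<sim>[at_top] (\<lambda>n. b k / (2 * sqrt pi) * r powi (- int n) * real n powr (-3/2))"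
      by (rule sqrt_type_asymp_equiv[OF r G bk])
    then show "fps_nth (G_gf m k) \<sim>[at_top] (\<lambda>n. b k / (2 * sqrt pi) * (4 * real m) ^ n * real n powr (-3/2))"
      unfolding powi .
  next
    fix i j assume ij: "i < m" "j < m"
    define A B where "A = a i * a j" and "B = a i * b j + a j * b i"
    have N: "sqrt_type r (N_gf m i j) A B"
      unfolding N_gf_eq A_def B_def using ab ij by (intro sqrt_type_mult r) auto
    \<comment> \<open>All a k and b k are positive, so B cannot vanish; the asymptotic equivalence
      and the singularity at r rest on this.\<close>
    have B: "B > 0" using ab ij by (simp add: B_def add_pos_pos)
    have nth: "fps_nth (N_gf m i j :: real fps) = (\<lambda>n. real (N_count m i j n))"
      by (rule ext) (simp add: N_gf_def)
    have asymp: "(\<lambda>n. real (N_count m i j n)) \<sim>[at_top] (\<lambda>n. B / (2 * sqrt pi) * r powi (- int n) * real n powr (-3/2))"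
      using sqrt_type_asymp_equiv[OF r N] B by (simp add: nth)
    have asymp': "(\<lambda>n. real (N_count m i j n)) \<sim>[at_top] (\<lambda>n. B / (2 * sqrt pi) * (4 * real m) ^ n * real n powr (-3/2))"
      using asymp unfolding powi .
    have "(\<lambda>n. real (N_count m i j n)) \<in> \<Theta>(\<lambda>n. B / (2 * sqrt pi) * ((4 * real m) ^ n * real n powr (-3/2)))"
      using asymp_equiv_imp_bigtheta[OF asymp'] by (simp only: mult.assoc)
    then have theta: "(\<lambda>n. real (N_count m i j n)) \<in> \<Theta>(\<lambda>n. (4 * real m) ^ n * real n powr (-3/2))"
      using B by simp
    have rad: "fps_conv_radius (N_gf m i j :: complex fps) = ereal r"
      using fps_conv_radius_of_real[OF N_gf_of_real] sqrt_type_conv_radius_eq[OF r N] B by simp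
    have rad_G: "ereal r \<le> fps_conv_radius (G_gf m k :: complex fps)" if "k < m" for k
      using fps_conv_radius_of_real[OF G_gf_of_real] sqrt_type_conv_radius[OF _ r] ab[OF that] by metis
    have "continuable (N_gf m i j) z" if "norm z = r" "z \<noteq> of_real r" for z
      unfolding N_gf_eq using ij that rad_G
      by (intro continuable_mult continuable_G_gf[OF m assms(2)]) auto
    moreover have "\<not> continuable (N_gf m i j) (of_real r)"
      using sqrt_type_not_continuable[OF r N _ N_gf_of_real] B by simp
    \<comment> \<open>The circle of convergence has radius r, and r is its only point without a
      continuation.\<close>
    ultimately have sing: "dominant_singularities (N_gf m i j) = {complex_of_real r}"
      unfolding dominant_singularities_def continuable_def [symmetric] rad using r by auto
    show "\<exists>A B :: real.
      B = a i * b j + a j * b i \<and>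
      (\<lambda>x. eval_fps (N_gf m i j) x - (A - B * sqrt (1 - x / r)))
        \<in> O[at_left r](\<lambda>x. 1 - x / r) \<and>
      (\<lambda>n. real (N_count m i j n)) \<sim>[at_top]
        (\<lambda>n. B / (2 * sqrt pi) * r powi (- int n) * real n powr (-3/2)) \<and>
      (\<lambda>n. real (N_count m i j n)) \<sim>[at_top]
        (\<lambda>n. B / (2 * sqrt pi) * (4 * real m) ^ n * real n powr (-3/2)) \<and>
      dominant_singularities (N_gf m i j) = {complex_of_real r} \<and>
      (\<lambda>n. real (N_count m i j n)) \<in> \<Theta>(\<lambda>n. (4 * real m) ^ n * real n powr (-3/2))"
      by (rule exI[of _ A], rule exI[of _ B], intro conjI B_def expansion[OF N] asymp asymp' sing theta)
  qed
qed

end
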